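(* Let $(E,\rho_E,[\cdot,\cdot]_E,J_E)$ be an almost complex Lie algebroid of rank $2m$ over a smooth manifold $M$, and let $\nabla$ be an almost complex connection on $E$ which is compatible with some Hermitian metric on $E$. With the $m\times m$ matrices of $2$-forms $\Phi$, $R=(R^b_a)$ and $R^*=(R^{b^*}_a)$ associated to $\nabla$ and to a local frame $\{e_a,J_E(e_a)\}_{a=1,\ldots,m}$ of $E$ as in the context, for every $k=0,1,\ldots,m$ the $E$-Chern form $\mathrm{trace}\,(i\Phi)^k$ of $E^{1,0}$ is, up to a nonzero (numerical) constant factor, the form on $E$ given by $$\mathrm{trace}\begin{pmatrix}R&-R^*\\R^*&R\end{pmatrix}^k,$$ i.e. the $E$-Chern forms of $E^{1,0}$ can be constructed using the matrix of $J_ER$, where $J_E$ is the almost complex structure of $E$ and $R$ (in $J_ER$) is the curvature of $\nabla$.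
   Context: A Lie algebroid $(E,\rho_E,[\cdot,\cdot]_E)$ over a smooth manifold $M$ is a real vector bundle $E\to M$ with a vector bundle morphism $\rho_E:E\to TM$ (the anchor) and a real Lie algebra bracket on $\Gamma(E)$ such that $\rho_E([s_1,s_2]_E)=[\rho_E(s_1),\rho_E(s_2)]$ and $[s_1,fs_2]_E=f[s_1,s_2]_E+\rho_E(s_1)(f)s_2$. An almost complex structure on $E$ is a vector bundle endomorphism $J_E$ over the identity with $J_E^2=-\mathrm{id}$. Forms on $E$ are sections of $\bigwedge^\bullet E^*$ (or of its complexification). A linear connection on $E$ is an $\mathbb R$-bilinear map $\nabla:\Gamma(E)\times\Gamma(E)\to\Gamma(E)$ with $\nabla_{fs_1}s_2=f\nabla_{s_1}s_2$, $\nabla_{s_1}(fs_2)=(\rho_E(s_1)f)s_2+f\nabla_{s_1}s_2$. It is almost complex if $\nabla_{s_1}(J_Es_2)=J_E(\nabla_{s_1}s_2)$ for all $s_1,s_2$. A Hermitian metric on $E$ is a Riemannian metric $g$ with $g(J_Es_1,J_Es_2)=g(s_1,s_2)$; $\nabla$ is compatible with $g$ if $\rho_E(s)(g(s_1,s_2))=g(\nabla_ss_1,s_2)+g(s_1,\nabla_ss_2)$. The curvature of $\nabla$ is $R(s_1,s_2)s_3=\nabla_{s_1}\nabla_{s_2}s_3-\nabla_{s_2}\nabla_{s_1}s_3-\nabla_{[s_1,s_2]_E}s_3$; it commutes with $J_E$ when $\nabla$ is almost complex. Let $E_{\mathbb C}=E\otimes\mathbb C=E^{1,0}\oplus E^{0,1}$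 be the decomposition into the $\pm i$ eigenbundles of $J_E$, and let $\nabla^{\mathbb C}$ be the $\mathbb C$-linear extension of $\nabla$, which preserves $E^{1,0}$, with curvature $R^{\mathbb C}$. Let $\{e_a,e_{a^*}=J_E(e_a)\}$, $a=1,\ldots,m$, be a local frame of $E$; then $e_a^{1,0}=e_a-ie_{a^*}$ is a local frame of $E^{1,0}$. Define real $2$-forms $R^b_a$, $R^{b^*}_a$ by $$J_ER(s_1,s_2)e_a=\sum_{b=1}^m\big(R^b_a(s_1,s_2)e_b+R^{b^*}_a(s_1,s_2)e_{b^*}\big),$$ so that $J_ER(s_1,s_2)e_{a^*}=\sum_b(-R^{b^*}_a(s_1,s_2)e_b+R^b_a(s_1,s_2)e_{b^*})$ and the matrix of $J_ER$ in the frame is $\begin{pmatrix}R&-R^*\\R^*&R\end{pmatrix}$, with $R=(R^b_a)$, $R^*=(R^{b^*}_a)$. The curvature matrix $\Phi=(\Phi^b_a)$ of complex $2$-forms is defined by $R^{\mathbb C}(s_1,s_2)e_a^{1,0}=\sum_b\Phi^b_a(s_1,s_2)e^{1,0}_b$. Powers of matrices of forms are taken with the exterior product. The $d_E$-closed forms $\mathrm{trace}\,(i\Phi)^k$ are the $E$-Chern forms of $E^{1,0}$ associated to $\nabla$ (they do not depend on the local frame; $d_E$ is the Lie algebroid differential). *)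

theory Defs
  imports "HOL-Analysis.Analysis" "HOL-Combinatorics.Permutations"
begin

section \<open>Smooth functions on open subsets of Euclidean space\<close>

text \<open>Euclidean n-space is the library's \<^const>\<open>Euclidean_space\<close>, that is, the functions
  \<open>nat \<Rightarrow> real\<close> that vanish from index \<open>n\<close> on, so that \<open>n = 0\<close> is allowed.\<close>

definition partial :: "nat \<Rightarrow> ((nat \<Rightarrow> real) \<Rightarrow> real) \<Rightarrow> (nat \<Rightarrow> real) \<Rightarrow> real"
  where "partial i f x = deriv (\<lambda>t. f (x(i := t))) (x i)"

text \<open>In the next two definitions \<open>W\<close> is meant to be open in \<^term>\<open>Euclidean_space n\<close>.\<close>

primrec Ck_on :: "nat \<Rightarrow> nat \<Rightarrow> (nat \<Rightarrow> real) set \<Rightarrow> ((nat \<Rightarrow> real) \<Rightarrow> real) \<Rightarrow> bool"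
  where
    "Ck_on 0 n W f \<longleftrightarrow> continuous_on W f"
  | "Ck_on (Suc k) n W f \<longleftrightarrow> continuous_on W f \<and>
       (\<forall>i<n. (\<forall>x\<in>W. (\<lambda>t. f (x(i := t))) field_differentiable at (x i)) \<and>
              Ck_on k n W (partial i f))"

definition Cinf_on :: "nat \<Rightarrow> (nat \<Rightarrow> real) set \<Rightarrow> ((nat \<Rightarrow> real) \<Rightarrow> real) \<Rightarrow> bool"
  where "Cinf_on n W f \<longleftrightarrow> (\<forall>k. Ck_on k n W f)"

section \<open>Smooth manifolds\<close>

text \<open>The manifold is the whole (Hausdorff, second countable) type \<open>'p\<close>; \<open>A\<close> is a smooth
  atlas, which need not be maximal.\<close>

locale smooth_manifold =
  fixes n :: nat
    and A :: "('p::{t2_space, second_countable_topology} set \<times> ('p \<Rightarrow> nat \<Rightarrow> real)) set"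
  assumes chart_open: "(V, \<phi>) \<in> A \<Longrightarrow> open V"
    and chart_image_open: "(V, \<phi>) \<in> A \<Longrightarrow> openin (Euclidean_space n) (\<phi> ` V)"
    and chart_homeomorphism:
      "(V, \<phi>) \<in> A \<Longrightarrow> homeomorphism V (\<phi> ` V) \<phi> (inv_into V \<phi>)"
    and chart_cover: "(\<Union>(V, \<phi>)\<in>A. V) = UNIV"
    and chart_transition:
      "\<lbrakk>(V, \<phi>) \<in> A; (V', \<phi>') \<in> A; i < n\<rbrakk> \<Longrightarrow>
         Cinf_on n (\<phi> ` (V \<inter> V')) (\<lambda>x. \<phi>' (inv_into V \<phi> x) i)"
begin

text \<open>Smoothness of \<open>f\<close> on an open set \<open>U\<close>.\<close>

definition smooth_on :: "'p set \<Rightarrow> ('p \<Rightarrow> real) \<Rightarrow> bool"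
  where "smooth_on U f \<longleftrightarrow>
    (\<forall>(V, \<phi>)\<in>A. Cinf_on n (\<phi> ` (U \<inter> V)) (\<lambda>x. f (inv_into V \<phi> x)))"

abbreviation smooth :: "('p \<Rightarrow> real) \<Rightarrow> bool"
  where "smooth \<equiv> smooth_on UNIV"

text \<open>Tangent vectors at \<open>p\<close> are the derivations at \<open>p\<close> of the algebra of smooth functions;
  their values at functions that are not smooth are irrelevant.\<close>

definition tangent_vector :: "'p \<Rightarrow> (('p \<Rightarrow> real) \<Rightarrow> real) \<Rightarrow> bool"
  where "tangent_vector p X \<longleftrightarrow>
    (\<forall>f h a b. smooth f \<longrightarrow> smooth h \<longrightarrow>
       X (\<lambda>q. a * f q + b * h q) = a * X f + b * X h \<and>
       X (\<lambda>q. f q * h q) = X f * h p + f p * X h)"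

end

section \<open>Vector bundles\<close>

text \<open>The fibre \<open>fib p\<close> of the bundle over \<open>p\<close> is a subspace of \<open>'v\<close>; the ambient space
  only provides the vector space operations, while the smooth structure comes from the set
  \<open>B\<close> of local trivializations \<open>\<psi> p : fib p \<rightarrow> \<real>\<^sup>r\<close> (\<open>p \<in> V\<close>) with smooth transition
  matrices. No relation between the positions of different fibres in \<open>'v\<close> is assumed.\<close>

locale vector_bundle = smooth_manifold n A
  for n :: nat
    and A :: "('p::{t2_space, second_countable_topology} set \<times> ('p \<Rightarrow> nat \<Rightarrow> real)) set" +
  fixes r :: nat
    and fib :: "'p \<Rightarrow> 'v::real_vector set"
    and B :: "('p set \<times> ('p \<Rightarrow> 'v \<Rightarrow> nat \<Rightarrow> real)) set"
  assumes fibre_subspace: "subspace (fib p)"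
    and triv_open: "(V, \<psi>) \<in> B \<Longrightarrow> open V"
    and triv_cover: "(\<Union>(V, \<psi>)\<in>B. V) = UNIV"
    and triv_bij: "\<lbrakk>(V, \<psi>) \<in> B; p \<in> V\<rbrakk> \<Longrightarrow>
      bij_betw (\<psi> p) (fib p) (topspace (Euclidean_space r))"
    and triv_linear: "\<lbrakk>(V, \<psi>) \<in> B; p \<in> V; u \<in> fib p; v \<in> fib p\<rbrakk> \<Longrightarrow>
      \<psi> p (a *\<^sub>R u + b *\<^sub>R v) i = a * \<psi> p u i + b * \<psi> p v i"
    and triv_transition: "\<lbrakk>(V, \<psi>) \<in> B; (V', \<psi>') \<in> B; i < r; j < r\<rbrakk> \<Longrightarrow>
      smooth_on (V \<inter> V')
        (\<lambda>p. \<psi>' p (inv_into (fib p) (\<psi> p) (\<lambda>l. if l = j then 1 else 0)) i)"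
begin

text \<open>Smooth sections over an open set \<open>U\<close> (with irrelevant values outside \<open>U\<close>).\<close>

definition sections :: "'p set \<Rightarrow> ('p \<Rightarrow> 'v) set"
  where "sections U = {s. (\<forall>p\<in>U. s p \<in> fib p) \<and>
    (\<forall>(V, \<psi>)\<in>B. \<forall>i<r. smooth_on (U \<inter> V) (\<lambda>p. \<psi> p (s p) i))}"

abbreviation Gam :: "('p \<Rightarrow> 'v) set"
  where "Gam \<equiv> sections UNIV"

definition bundle_endomorphism :: "('p \<Rightarrow> 'v \<Rightarrow> 'v) \<Rightarrow> bool"
  where "bundle_endomorphism F \<longleftrightarrow>
    (\<forall>p. \<forall>u\<in>fib p. F p u \<in> fib p) \<and>
    (\<forall>p a b. \<forall>u\<in>fib p. \<forall>v\<in>fib p. F p (a *\<^sub>R u + b *\<^sub>R v) = a *\<^sub>R F p u + b *\<^sub>R F p v) \<and>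
    (\<forall>U. open U \<longrightarrow> (\<forall>s\<in>sections U. (\<lambda>p. F p (s p)) \<in> sections U))"

definition riemannian_metric :: "('p \<Rightarrow> 'v \<Rightarrow> 'v \<Rightarrow> real) \<Rightarrow> bool"
  where "riemannian_metric g \<longleftrightarrow>
    (\<forall>p a b. \<forall>u\<in>fib p. \<forall>v\<in>fib p. \<forall>w\<in>fib p.
       g p (a *\<^sub>R u + b *\<^sub>R v) w = a * g p u w + b * g p v w) \<and>
    (\<forall>p. \<forall>u\<in>fib p. \<forall>v\<in>fib p. g p u v = g p v u) \<and>
    (\<forall>p. \<forall>u\<in>fib p. u \<noteq> 0 \<longrightarrow> g p u u > 0) \<and>
    (\<forall>U. open U \<longrightarrow> (\<forall>s\<in>sections U. \<forall>t\<in>sections U. smooth_on U (\<lambda>p. g p (s p) (t p))))"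

end

section \<open>Almost complex Lie algebroids\<close>

text \<open>The anchor is a bundle morphism to the tangent bundle: \<open>\<rho> p u\<close> is a tangent vector at
  \<open>p\<close>, that is, a derivation, for \<open>u\<close> in \<open>fib p\<close>.\<close>

locale lie_algebroid = vector_bundle n A r fib B
  for n :: nat
    and A :: "('p::{t2_space, second_countable_topology} set \<times> ('p \<Rightarrow> nat \<Rightarrow> real)) set"
    and r :: nat
    and fib :: "'p \<Rightarrow> 'v::real_vector set"
    and B :: "('p set \<times> ('p \<Rightarrow> 'v \<Rightarrow> nat \<Rightarrow> real)) set" +
  fixes \<rho> :: "'p \<Rightarrow> 'v \<Rightarrow> ('p \<Rightarrow> real) \<Rightarrow> real"
    and br :: "('p \<Rightarrow> 'v) \<Rightarrow> ('p \<Rightarrow> 'v) \<Rightarrow> 'p \<Rightarrow> 'v"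
  assumes anchor_tangent: "u \<in> fib p \<Longrightarrow> tangent_vector p (\<rho> p u)"
    and anchor_linear: "\<lbrakk>u \<in> fib p; v \<in> fib p; smooth f\<rbrakk> \<Longrightarrow>
      \<rho> p (a *\<^sub>R u + b *\<^sub>R v) f = a * \<rho> p u f + b * \<rho> p v f"
    and anchor_smooth: "\<lbrakk>open U; s \<in> sections U; smooth f\<rbrakk> \<Longrightarrow>
      smooth_on U (\<lambda>p. \<rho> p (s p) f)"
    and bracket_closed: "\<lbrakk>s \<in> Gam; t \<in> Gam\<rbrakk> \<Longrightarrow> br s t \<in> Gam"
    and bracket_linear: "\<lbrakk>s1 \<in> Gam; s2 \<in> Gam; t \<in> Gam\<rbrakk> \<Longrightarrow>
      br (\<lambda>p. a *\<^sub>R s1 p + b *\<^sub>R s2 p) t = (\<lambda>p. a *\<^sub>R br s1 t p + b *\<^sub>R br s2 t p)"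
    and bracket_skew: "\<lbrakk>s \<in> Gam; t \<in> Gam\<rbrakk> \<Longrightarrow> br s t = (\<lambda>p. - br t s p)"
    and bracket_jacobi: "\<lbrakk>s1 \<in> Gam; s2 \<in> Gam; s3 \<in> Gam\<rbrakk> \<Longrightarrow>
      br s1 (br s2 s3) p + br s2 (br s3 s1) p + br s3 (br s1 s2) p = 0"
    and anchor_bracket: "\<lbrakk>s \<in> Gam; t \<in> Gam; smooth f\<rbrakk> \<Longrightarrow>
      \<rho> p (br s t p) f =
        \<rho> p (s p) (\<lambda>q. \<rho> q (t q) f) - \<rho> p (t p) (\<lambda>q. \<rho> q (s q) f)"
    and bracket_leibniz: "\<lbrakk>s \<in> Gam; t \<in> Gam; smooth f\<rbrakk> \<Longrightarrow>
      br s (\<lambda>p. f p *\<^sub>R t p) = (\<lambda>p. f p *\<^sub>R br s t p + \<rho> p (s p) f *\<^sub>R t p)"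
begin

definition linear_connection :: "(('p \<Rightarrow> 'v) \<Rightarrow> ('p \<Rightarrow> 'v) \<Rightarrow> 'p \<Rightarrow> 'v) \<Rightarrow> bool"
  where "linear_connection nab \<longleftrightarrow>
    (\<forall>s\<in>Gam. \<forall>t\<in>Gam. nab s t \<in> Gam) \<and>
    (\<forall>s1\<in>Gam. \<forall>s2\<in>Gam. \<forall>t\<in>Gam. \<forall>a b.
       nab (\<lambda>p. a *\<^sub>R s1 p + b *\<^sub>R s2 p) t = (\<lambda>p. a *\<^sub>R nab s1 t p + b *\<^sub>R nab s2 t p) \<and>
       nab t (\<lambda>p. a *\<^sub>R s1 p + b *\<^sub>R s2 p) = (\<lambda>p. a *\<^sub>R nab t s1 p + b *\<^sub>R nab t s2 p)) \<and>
    (\<forall>s\<in>Gam. \<forall>t\<in>Gam. \<forall>f. smooth f \<longrightarrow>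
       nab (\<lambda>p. f p *\<^sub>R s p) t = (\<lambda>p. f p *\<^sub>R nab s t p) \<and>
       nab s (\<lambda>p. f p *\<^sub>R t p) = (\<lambda>p. \<rho> p (s p) f *\<^sub>R t p + f p *\<^sub>R nab s t p))"

definition metric_compatible ::
    "('p \<Rightarrow> 'v \<Rightarrow> 'v \<Rightarrow> real) \<Rightarrow> (('p \<Rightarrow> 'v) \<Rightarrow> ('p \<Rightarrow> 'v) \<Rightarrow> 'p \<Rightarrow> 'v) \<Rightarrow> bool"
  where "metric_compatible g nab \<longleftrightarrow>
    (\<forall>s\<in>Gam. \<forall>s1\<in>Gam. \<forall>s2\<in>Gam. \<forall>p.
       \<rho> p (s p) (\<lambda>q. g q (s1 q) (s2 q)) =
         g p (nab s s1 p) (s2 p) + g p (s1 p) (nab s s2 p))"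

end

locale almost_complex_lie_algebroid = lie_algebroid n A "2 * m" fib B \<rho> br
  for n :: nat
    and A :: "('p::{t2_space, second_countable_topology} set \<times> ('p \<Rightarrow> nat \<Rightarrow> real)) set"
    and m :: nat
    and fib :: "'p \<Rightarrow> 'v::real_vector set"
    and B :: "('p set \<times> ('p \<Rightarrow> 'v \<Rightarrow> nat \<Rightarrow> real)) set"
    and \<rho> :: "'p \<Rightarrow> 'v \<Rightarrow> ('p \<Rightarrow> real) \<Rightarrow> real"
    and br :: "('p \<Rightarrow> 'v) \<Rightarrow> ('p \<Rightarrow> 'v) \<Rightarrow> 'p \<Rightarrow> 'v" +
  fixes J :: "'p \<Rightarrow> 'v \<Rightarrow> 'v"
  assumes J_endomorphism: "bundle_endomorphism J"
    and J_squared: "u \<in> fib p \<Longrightarrow> J p (J p u) = - u"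
begin

definition hermitian_metric :: "('p \<Rightarrow> 'v \<Rightarrow> 'v \<Rightarrow> real) \<Rightarrow> bool"
  where "hermitian_metric g \<longleftrightarrow> riemannian_metric g \<and>
    (\<forall>p. \<forall>u\<in>fib p. \<forall>v\<in>fib p. g p (J p u) (J p v) = g p u v)"

definition almost_complex_connection ::
    "(('p \<Rightarrow> 'v) \<Rightarrow> ('p \<Rightarrow> 'v) \<Rightarrow> 'p \<Rightarrow> 'v) \<Rightarrow> bool"
  where "almost_complex_connection nab \<longleftrightarrow> linear_connection nab \<and>
    (\<forall>s\<in>Gam. \<forall>t\<in>Gam. nab s (\<lambda>p. J p (t p)) = (\<lambda>p. J p (nab s t p)))"

end

section \<open>Matrices of forms\<close>

text \<open>A form of degree \<open>d\<close>, with values in a field \<open>'k\<close> (here \<open>real\<close> or \<open>complex\<close>), is evaluated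
  at a point \<open>p\<close> and at the vectors \<open>v 0, \<dots>, v (d - 1)\<close> of the fibre over \<open>p\<close>. Forms with values
  in \<open>complex\<close> are the sections of the exterior powers of the complexified dual bundle.\<close>

type_synonym ('p, 'v, 'k) form = "'p \<Rightarrow> (nat \<Rightarrow> 'v) \<Rightarrow> 'k"

definition wedge ::
    "nat \<Rightarrow> nat \<Rightarrow> ('p, 'v, 'k::field_char_0) form \<Rightarrow> ('p, 'v, 'k) form \<Rightarrow> ('p, 'v, 'k) form"
  where "wedge d d' \<alpha> \<beta> = (\<lambda>p v. (\<Sum>\<sigma> | \<sigma> permutes {..<d + d'}.
    of_int (sign \<sigma>) * \<alpha> p (\<lambda>i. v (\<sigma> i)) * \<beta> p (\<lambda>i. v (\<sigma> (d + i)))) / (fact d * fact d'))"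

text \<open>The \<open>k\<close>-th exterior power of a square matrix of size \<open>N\<close> of forms of degree 2: a matrix of
  forms of degree \<open>2 * k\<close>. Here \<open>X b a\<close> is the entry in row \<open>b\<close> and column \<open>a\<close>.\<close>

primrec form_matrix_power ::
    "nat \<Rightarrow> (nat \<Rightarrow> nat \<Rightarrow> ('p, 'v, 'k::field_char_0) form) \<Rightarrow> nat \<Rightarrow>
     nat \<Rightarrow> nat \<Rightarrow> ('p, 'v, 'k) form"
  where
    "form_matrix_power N X 0 = (\<lambda>b a p v. if b = a then 1 else 0)"
  | "form_matrix_power N X (Suc k) = (\<lambda>b a p v.
       \<Sum>c<N. wedge (2 * k) 2 (form_matrix_power N X k b c) (X c a) p v)"

definition form_trace ::
    "nat \<Rightarrow> (nat \<Rightarrow> nat \<Rightarrow> ('p, 'v, 'k::field_char_0) form) \<Rightarrow> ('p, 'v, 'k) form"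
  where "form_trace N X = (\<lambda>p v. \<Sum>a<N. X a a p v)"

text \<open>The block matrix with rows \<open>(X, -Y)\<close> and \<open>(Y, X)\<close>.\<close>

definition block_matrix ::
    "nat \<Rightarrow> (nat \<Rightarrow> nat \<Rightarrow> ('p, 'v, 'k::field_char_0) form) \<Rightarrow>
     (nat \<Rightarrow> nat \<Rightarrow> ('p, 'v, 'k) form) \<Rightarrow> nat \<Rightarrow> nat \<Rightarrow> ('p, 'v, 'k) form"
  where "block_matrix m X Y b a = (\<lambda>p v.
    if b < m then (if a < m then X b a p v else - Y b (a - m) p v)
    else (if a < m then Y (b - m) a p v else X (b - m) (a - m) p v))"

section \<open>Curvature\<close>

text \<open>The second type \<open>'w\<close> is the one of the bundle itself or of its complexification.\<close>

definition curvature ::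
    "(('p \<Rightarrow> 'v) \<Rightarrow> ('p \<Rightarrow> 'v) \<Rightarrow> 'p \<Rightarrow> 'v) \<Rightarrow>
     (('p \<Rightarrow> 'v) \<Rightarrow> ('p \<Rightarrow> 'w::real_vector) \<Rightarrow> 'p \<Rightarrow> 'w) \<Rightarrow>
     ('p \<Rightarrow> 'v) \<Rightarrow> ('p \<Rightarrow> 'v) \<Rightarrow> ('p \<Rightarrow> 'w) \<Rightarrow> 'p \<Rightarrow> 'w"
  where "curvature br nab s1 s2 s3 = (\<lambda>p.
    nab s1 (nab s2 s3) p - nab s2 (nab s1 s3) p - nab (br s1 s2) s3 p)"

text \<open>The curvature is tensorial, so that its value at \<open>p\<close> depends only on the values \<open>u\<close>, \<open>v\<close>,
  \<open>w\<close> of the three sections at \<open>p\<close>; this allows one to apply it to local sections as well. \<open>S\<close>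
  and \<open>S'\<close> are the spaces of global sections for the first two arguments and for the third one.\<close>

definition tensor_at ::
    "('p \<Rightarrow> 'v) set \<Rightarrow> ('p \<Rightarrow> 'w) set \<Rightarrow>
     (('p \<Rightarrow> 'v) \<Rightarrow> ('p \<Rightarrow> 'v) \<Rightarrow> ('p \<Rightarrow> 'w) \<Rightarrow> 'p \<Rightarrow> 'w) \<Rightarrow> 'p \<Rightarrow> 'v \<Rightarrow> 'v \<Rightarrow> 'w \<Rightarrow> 'w"
  where "tensor_at S S' T p u v w = (THE y. \<exists>s1\<in>S. \<exists>s2\<in>S. \<exists>s3\<in>S'.
    s1 p = u \<and> s2 p = v \<and> s3 p = w \<and> y = T s1 s2 s3 p)"

text \<open>In the complexification of a real vector space the pair \<open>(x, y)\<close> stands for \<open>x + \<i> y\<close>.\<close>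

definition cscale :: "complex \<Rightarrow> 'v::real_vector \<times> 'v \<Rightarrow> 'v \<times> 'v"
  where "cscale z w =
    (Re z *\<^sub>R fst w - Im z *\<^sub>R snd w, Re z *\<^sub>R snd w + Im z *\<^sub>R fst w)"

definition complexify_connection ::
    "(('p \<Rightarrow> 'v) \<Rightarrow> ('p \<Rightarrow> 'v) \<Rightarrow> 'p \<Rightarrow> 'v) \<Rightarrow> ('p \<Rightarrow> 'v) \<Rightarrow> ('p \<Rightarrow> 'v \<times> 'v) \<Rightarrow> 'p \<Rightarrow> 'v \<times> 'v"
  where "complexify_connection nab s w =
    (\<lambda>p. (nab s (\<lambda>q. fst (w q)) p, nab s (\<lambda>q. snd (w q)) p))"

context almost_complex_lie_algebroid
begin

definition GamC :: "('p \<Rightarrow> 'v \<times> 'v) set"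
  where "GamC = {w. (\<lambda>p. fst (w p)) \<in> Gam \<and> (\<lambda>p. snd (w p)) \<in> Gam}"

definition curv ::
    "(('p \<Rightarrow> 'v) \<Rightarrow> ('p \<Rightarrow> 'v) \<Rightarrow> 'p \<Rightarrow> 'v) \<Rightarrow> 'p \<Rightarrow> 'v \<Rightarrow> 'v \<Rightarrow> 'v \<Rightarrow> 'v"
  where "curv nab = tensor_at Gam Gam (curvature br nab)"

text \<open>The first two arguments of the complex curvature are taken real, since complex-valued forms
  are determined by their values at real vectors.\<close>

definition curvC ::
    "(('p \<Rightarrow> 'v) \<Rightarrow> ('p \<Rightarrow> 'v) \<Rightarrow> 'p \<Rightarrow> 'v) \<Rightarrow> 'p \<Rightarrow> 'v \<Rightarrow> 'v \<Rightarrow> 'v \<times> 'v \<Rightarrow> 'v \<times> 'v"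
  where "curvC nab = tensor_at Gam GamC (curvature br (complexify_connection nab))"

section \<open>Local frames, curvature matrices and Chern forms\<close>

text \<open>\<open>e 0, \<dots>, e (m - 1)\<close> are local sections; \<open>frame_vec e p i\<close> is \<open>e i p\<close> for \<open>i < m\<close>, and
  \<open>J (e (i - m))\<close> at \<open>p\<close> for \<open>m \<le> i < 2 * m\<close>.\<close>

definition frame_vec :: "(nat \<Rightarrow> 'p \<Rightarrow> 'v) \<Rightarrow> 'p \<Rightarrow> nat \<Rightarrow> 'v"
  where "frame_vec e p i = (if i < m then e i p else J p (e (i - m) p))"

definition local_J_frame :: "'p set \<Rightarrow> (nat \<Rightarrow> 'p \<Rightarrow> 'v) \<Rightarrow> bool"
  where "local_J_frame U e \<longleftrightarrow> open U \<and> (\<forall>a<m. e a \<in> sections U) \<and>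
    (\<forall>p\<in>U. inj_on (frame_vec e p) {..<2 * m} \<and>
           independent (frame_vec e p ` {..<2 * m}) \<and>
           span (frame_vec e p ` {..<2 * m}) = fib p)"

definition frame_coord :: "(nat \<Rightarrow> 'p \<Rightarrow> 'v) \<Rightarrow> 'p \<Rightarrow> 'v \<Rightarrow> nat \<Rightarrow> real"
  where "frame_coord e p u = (THE c. (\<forall>i\<ge>2 * m. c i = 0) \<and>
    u = (\<Sum>i<2 * m. c i *\<^sub>R frame_vec e p i))"

text \<open>The coordinate of \<open>J R(v\<^sub>0, v\<^sub>1) e\<^sub>a\<close> at \<open>e\<^sub>b\<close>, and the one at \<open>J e\<^sub>b\<close>.\<close>

definition R_form ::
    "(('p \<Rightarrow> 'v) \<Rightarrow> ('p \<Rightarrow> 'v) \<Rightarrow> 'p \<Rightarrow> 'v) \<Rightarrow> (nat \<Rightarrow> 'p \<Rightarrow> 'v) \<Rightarrow>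
     nat \<Rightarrow> nat \<Rightarrow> ('p, 'v, real) form"
  where "R_form nab e b a = (\<lambda>p v.
    frame_coord e p (J p (curv nab p (v 0) (v 1) (e a p))) b)"

definition R_star_form ::
    "(('p \<Rightarrow> 'v) \<Rightarrow> ('p \<Rightarrow> 'v) \<Rightarrow> 'p \<Rightarrow> 'v) \<Rightarrow> (nat \<Rightarrow> 'p \<Rightarrow> 'v) \<Rightarrow>
     nat \<Rightarrow> nat \<Rightarrow> ('p, 'v, real) form"
  where "R_star_form nab e b a = (\<lambda>p v.
    frame_coord e p (J p (curv nab p (v 0) (v 1) (e a p))) (m + b))"

text \<open>\<open>e\<^sub>a - \<i> J e\<^sub>a\<close>, the induced local frame of the \<open>\<i>\<close>-eigenbundle of \<open>J\<close>.\<close>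

definition frame10 :: "(nat \<Rightarrow> 'p \<Rightarrow> 'v) \<Rightarrow> nat \<Rightarrow> 'p \<Rightarrow> 'v \<times> 'v"
  where "frame10 e a p = (e a p, - J p (e a p))"

definition frame10_coord :: "(nat \<Rightarrow> 'p \<Rightarrow> 'v) \<Rightarrow> 'p \<Rightarrow> 'v \<times> 'v \<Rightarrow> nat \<Rightarrow> complex"
  where "frame10_coord e p w = (THE c. (\<forall>b\<ge>m. c b = 0) \<and>
    w = (\<Sum>b<m. cscale (c b) (frame10 e b p)))"

definition curvature_matrix ::
    "(('p \<Rightarrow> 'v) \<Rightarrow> ('p \<Rightarrow> 'v) \<Rightarrow> 'p \<Rightarrow> 'v) \<Rightarrow> (nat \<Rightarrow> 'p \<Rightarrow> 'v) \<Rightarrow>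
     nat \<Rightarrow> nat \<Rightarrow> ('p, 'v, complex) form"
  where "curvature_matrix nab e b a = (\<lambda>p v.
    frame10_coord e p (curvC nab p (v 0) (v 1) (frame10 e a p)) b)"

definition chern_form ::
    "(('p \<Rightarrow> 'v) \<Rightarrow> ('p \<Rightarrow> 'v) \<Rightarrow> 'p \<Rightarrow> 'v) \<Rightarrow> (nat \<Rightarrow> 'p \<Rightarrow> 'v) \<Rightarrow> nat \<Rightarrow>
     ('p, 'v, complex) form"
  where "chern_form nab e k = form_trace m
    (form_matrix_power m (\<lambda>b a p v. \<i> * curvature_matrix nab e b a p v) k)"

definition JR_trace_form ::
    "(('p \<Rightarrow> 'v) \<Rightarrow> ('p \<Rightarrow> 'v) \<Rightarrow> 'p \<Rightarrow> 'v) \<Rightarrow> (nat \<Rightarrow> 'p \<Rightarrow> 'v) \<Rightarrow> nat \<Rightarrow>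
     ('p, 'v, real) form"
  where "JR_trace_form nab e k = form_trace (2 * m)
    (form_matrix_power (2 * m) (block_matrix m (R_form nab e) (R_star_form nab e)) k)"

end

end

theory Submission
  imports Defs
begin

text \<open>Fix a point \<open>p\<close> of the domain of the frame and vectors \<open>x\<close>, \<open>y\<close> of the fibre over \<open>p\<close>.
  On the \<open>\<i>\<close>-eigenbundle \<open>J\<close> is multiplication by \<open>\<i>\<close>, so that \<open>\<i> \<Phi>\<close> is the matrix of \<open>J R\<close> there; in
  the frame \<open>e\<^sub>a - \<i> J e\<^sub>a\<close> it equals \<open>R + \<i> R\<^sup>*\<close> (lemma \<open>curvature_matrix_eq\<close>). The block matrix
  with rows \<open>(R, -R\<^sup>*)\<close> and \<open>(R\<^sup>*, R)\<close> is the real form of this complex matrix, and the trace of the real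
  form of a complex matrix is twice the real part of its trace. Hence the trace of the \<open>k\<close>-th power
  of the block matrix is \<open>2 Re (trace (\<i> \<Phi>)\<^sup>k)\<close>, and it remains to see that \<open>trace (\<i> \<Phi>)\<^sup>k\<close> is
  real; the constant is then \<open>1/2\<close>.

  For this the exterior power is expanded: up to the factor \<open>2\<^sup>-\<^sup>k\<close>, the value of the trace at
  \<open>v\<^sub>0, \<dots>, v\<^sub>2\<^sub>k\<^sub>-\<^sub>1\<close> is the alternating sum over the permutations \<open>\<sigma>\<close> of the traces of the ordinary
  matrix products \<open>M\<^sub>0 \<cdots> M\<^sub>k\<^sub>-\<^sub>1\<close>, where \<open>M\<^sub>j\<close> is the matrix at the \<open>j\<close>-th pair of permuted
  vectors (lemma \<open>form_trace_power_eq\<close>). The imaginary part of such a trace is \<open>-1/2\<close> times the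
  real trace of the operator \<open>J \<circ> J R(x\<^sub>0, y\<^sub>0) \<circ> \<cdots> \<circ> J R(x\<^sub>k\<^sub>-\<^sub>1, y\<^sub>k\<^sub>-\<^sub>1)\<close>. With respect to the
  Hermitian metric, each \<open>J R(x, y)\<close> is self-adjoint and \<open>J\<close> is skew-adjoint, so that passing
  to the adjoint operator changes the sign of this trace and reverses the order of the factors
  (lemma \<open>mtrace_reverse\<close>). On the other hand, reversing the order of \<open>k\<close> pairs is an even
  permutation of the \<open>2 k\<close> vectors (lemma \<open>sign_reverse_pairs\<close>) and does not change the alternating
  sum, which is therefore zero (lemma \<open>sum_Im_trace_term\<close>).

  The curvature at a point is given through arbitrary global sections with prescribed values at that
  point. That such sections exist and that the result does not depend on their choice
  (lemmas \<open>section_through\<close> and \<open>curvature_tensorial\<close>) rests on smooth bump functions, which are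
  constructed first.\<close>

section \<open>Calculus of \<open>C\<^sup>k\<close> functions on Euclidean space\<close>

lemma continuous_on_fun_upd: "continuous_on UNIV (\<lambda>t. (x::nat \<Rightarrow> real)(i := t))"
proof (rule continuous_on_coordinatewise_then_product)
  show "continuous_on UNIV (\<lambda>t. (x(i := t)) j)" for j
    by (cases "j = i") (auto intro!: continuous_intros)
qed

lemma openin_Euclidean_space_iff:
  "openin (Euclidean_space n) W \<longleftrightarrow> (\<exists>S. open S \<and> W = S \<inter> {x. \<forall>i\<ge>n. x i = 0})"
  by (simp add: Euclidean_space_def euclidean_product_topology openin_subtopology)

lemma eventually_fun_upd_in:
  assumes "openin (Euclidean_space n) W" "x \<in> W" "i < n"
  shows "eventually (\<lambda>t. x(i := t) \<in> W) (nhds (x i))"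
proof -
  obtain S where S: "open S" "W = S \<inter> {x. \<forall>i\<ge>n. x i = 0}"
    using assms(1) openin_Euclidean_space_iff by blast
  have "open ((\<lambda>t. x(i := t)) -` S)"
    using continuous_on_fun_upd S(1) by (simp add: continuous_on_open_vimage)
  moreover have "x i \<in> (\<lambda>t. x(i := t)) -` S"
    using assms S by simp
  ultimately have "eventually (\<lambda>t. t \<in> (\<lambda>t. x(i := t)) -` S) (nhds (x i))"
    by (rule eventually_nhds_in_open)
  then show ?thesis
    by eventually_elim (use assms S in auto)
qed

lemma Ck_on_imp_continuous: "Ck_on k n W f \<Longrightarrow> continuous_on W f"
  by (cases k) auto

lemma Ck_on_Suc_D:
  assumes "Ck_on (Suc k) n W f" "i < n" "x \<in> W"
  shows "((\<lambda>t. f (x(i := t))) has_field_derivative partial i f x) (at (x i))"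
  using assms by (auto simp: partial_def field_differentiable_derivI)

lemma Ck_on_SucI:
  assumes "openin (Euclidean_space n) W" "continuous_on W f"
    and "\<And>i x. i < n \<Longrightarrow> x \<in> W \<Longrightarrow>
      ((\<lambda>t. f (x(i := t))) has_field_derivative D i x) (at (x i))"
    and "\<And>i. i < n \<Longrightarrow> Ck_on k n W (partial i f)"
  shows "Ck_on (Suc k) n W f"
  using assms by (auto simp: field_differentiable_def)

text \<open>Openness of \<open>W\<close> is needed because the partial derivatives at a point of \<open>W\<close> involve the values
  at nearby points.\<close>

lemma Ck_on_cong:
  assumes W: "openin (Euclidean_space n) W"
  shows "(\<And>x. x \<in> W \<Longrightarrow> f x = h x) \<Longrightarrow> Ck_on k n W f \<Longrightarrow> Ck_on k n W h"
proof (induction k arbitrary: f h)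
  case 0
  then show ?case by (auto cong: continuous_on_cong)
next
  case (Suc k)
  have ev: "eventually (\<lambda>t. f (x(i := t)) = h (x(i := t))) (nhds (x i))" if "x \<in> W" "i < n" for x i
    using eventually_fun_upd_in[OF W that] by eventually_elim (rule Suc.prems(1))
  have p: "partial i f x = partial i h x" if "x \<in> W" "i < n" for x i
    unfolding partial_def by (rule deriv_cong_ev) (use ev[OF that] in auto)
  show ?case
  proof (rule Ck_on_SucI[OF W])
    show "continuous_on W h"
      using Suc.prems Ck_on_imp_continuous by (auto cong: continuous_on_cong)
    show "((\<lambda>t. h (x(i := t))) has_field_derivative partial i f x) (at (x i))"
      if "i < n" "x \<in> W" for i x
      using Ck_on_Suc_D[OF Suc.prems(2) that] DERIV_cong_ev[OF refl ev[OF that(2,1)] refl]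
      by blast
    show "Ck_on k n W (partial i h)" if "i < n" for i
      by (rule Suc.IH[of "partial i f"]) (use p that Suc.prems in auto)
  qed
qed

lemma Ck_on_SucI':
  assumes W: "openin (Euclidean_space n) W" and "continuous_on W f"
    and D: "\<And>i x. i < n \<Longrightarrow> x \<in> W \<Longrightarrow>
      ((\<lambda>t. f (x(i := t))) has_field_derivative D i x) (at (x i))"
    and C: "\<And>i. i < n \<Longrightarrow> Ck_on k n W (D i)"
  shows "Ck_on (Suc k) n W f"
proof (rule Ck_on_SucI[OF W assms(2) D])
  show "Ck_on k n W (partial i f)" if "i < n" for i
    by (rule Ck_on_cong[OF W _ C[OF that]])
      (use DERIV_imp_deriv[OF D] that in \<open>simp add: partial_def\<close>)
qed

lemma Ck_on_decrease: "Ck_on (Suc k) n W f \<Longrightarrow> Ck_on k n W f"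
  by (induction k arbitrary: f) auto

lemma Ck_on_const:
  assumes W: "openin (Euclidean_space n) W"
  shows "Ck_on k n W (\<lambda>x. c)"
proof (induction k arbitrary: c)
  case (Suc k)
  show ?case
    by (rule Ck_on_SucI'[OF W, where D = "\<lambda>_ _. 0"]) (auto intro: Suc)
qed simp

lemma Ck_on_add:
  assumes W: "openin (Euclidean_space n) W"
  shows "Ck_on k n W f \<Longrightarrow> Ck_on k n W h \<Longrightarrow> Ck_on k n W (\<lambda>x. f x + h x)"
proof (induction k arbitrary: f h)
  case 0
  then show ?case by (auto intro: continuous_intros)
next
  case (Suc k)
  show ?case
  proof (rule Ck_on_SucI'[OF W])
    show "continuous_on W (\<lambda>x. f x + h x)"
      by (intro continuous_intros Ck_on_imp_continuous[OF Suc.prems(1)]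
          Ck_on_imp_continuous[OF Suc.prems(2)])
    show "((\<lambda>t. f (x(i := t)) + h (x(i := t))) has_field_derivative
        partial i f x + partial i h x) (at (x i))" if "i < n" "x \<in> W" for i x
      by (intro DERIV_add Ck_on_Suc_D[OF Suc.prems(1) that] Ck_on_Suc_D[OF Suc.prems(2) that])
    show "Ck_on k n W (\<lambda>x. partial i f x + partial i h x)" if "i < n" for i
      by (rule Suc.IH) (use Suc.prems that in auto)
  qed
qed

lemma Ck_on_mult:
  assumes W: "openin (Euclidean_space n) W"
  shows "Ck_on k n W f \<Longrightarrow> Ck_on k n W h \<Longrightarrow> Ck_on k n W (\<lambda>x. f x * h x)"
proof (induction k arbitrary: f h)
  case 0
  then show ?case by (auto intro: continuous_intros)
next
  case (Suc k)
  show ?case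
  proof (rule Ck_on_SucI'[OF W])
    show "continuous_on W (\<lambda>x. f x * h x)"
      by (intro continuous_intros Ck_on_imp_continuous[OF Suc.prems(1)]
          Ck_on_imp_continuous[OF Suc.prems(2)])
    show "((\<lambda>t. f (x(i := t)) * h (x(i := t))) has_field_derivative
        partial i f x * h x + partial i h x * f x) (at (x i))" if "i < n" "x \<in> W" for i x
      using DERIV_mult[OF Ck_on_Suc_D[OF Suc.prems(1) that] Ck_on_Suc_D[OF Suc.prems(2) that]]
      by (simp only: fun_upd_triv)
    show "Ck_on k n W (\<lambda>x. partial i f x * h x + partial i h x * f x)" if "i < n" for i
      using Suc.prems that Suc.prems[THEN Ck_on_decrease]
      by (intro Ck_on_add[OF W] Suc.IH) auto
  qed
qed

lemma Ck_on_local: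
  assumes W: "openin (Euclidean_space n) W"
    and loc: "\<And>x. x \<in> W \<Longrightarrow>
      \<exists>W'. openin (Euclidean_space n) W' \<and> x \<in> W' \<and> W' \<subseteq> W \<and> Ck_on k n W' f"
  shows "Ck_on k n W f"
  using loc
proof (induction k arbitrary: f)
  case (0 f)
  have "continuous (at x within W) f" if x: "x \<in> W" for x
  proof -
    obtain W' where W': "openin (Euclidean_space n) W'" "x \<in> W'" "W' \<subseteq> W" "continuous_on W' f"
      using 0[OF x] by auto
    obtain S where S: "open S" "W' = S \<inter> {x. \<forall>i\<ge>n. x i = 0}"
      using W'(1) openin_Euclidean_space_iff by blast
    have "W \<subseteq> {x. \<forall>i\<ge>n. x i = 0}"
      using W openin_Euclidean_space_iff by blast
    then have "W' \<inter> S = W \<inter> S"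
      using S W'(3) by auto
    then have "at x within W' = at x within W"
      using S(1) W'(2) S(2) by (intro at_within_nhd[of _ S]) auto
    then show ?thesis
      using W'(2,4) by (metis continuous_on_eq_continuous_within)
  qed
  then show ?case
    by (simp add: continuous_on_eq_continuous_within)
next
  case (Suc k)
  show ?case
  proof (rule Ck_on_SucI[OF W])
    have "Ck_on k n W f"
    proof (rule Suc.IH)
      show "\<exists>W'. openin (Euclidean_space n) W' \<and> x \<in> W' \<and> W' \<subseteq> W \<and> Ck_on k n W' f"
        if "x \<in> W" for x
        using Suc.prems[OF that] Ck_on_decrease by metis
    qed
    then show "continuous_on W f"
      by (rule Ck_on_imp_continuous)
    show "((\<lambda>t. f (x(i := t))) has_field_derivative partial i f x) (at (x i))"
      if "i < n" "x \<in> W" for i x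
    proof -
      obtain W' where "x \<in> W'" "Ck_on (Suc k) n W' f"
        using Suc.prems[OF \<open>x \<in> W\<close>] by metis
      then show ?thesis
        using Ck_on_Suc_D \<open>i < n\<close> by metis
    qed
    show "Ck_on k n W (partial i f)" if "i < n" for i
    proof (rule Suc.IH)
      show "\<exists>W'. openin (Euclidean_space n) W' \<and> x \<in> W' \<and> W' \<subseteq> W \<and> Ck_on k n W' (partial i f)"
        if "x \<in> W" for x
        using Suc.prems[OF that] \<open>i < n\<close> by auto
    qed
  qed
qed

section \<open>Bump functions on the line\<close>

text \<open>The functions \<open>x \<mapsto> x\<^sup>-\<^sup>j exp (-1/x)\<close> for \<open>x > 0\<close>, extended by zero. The derivative of one
  of them is a linear combination of two others, so that this family is closed under
  differentiation, which makes all of its members smooth.\<close>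

definition flat_exp :: "nat \<Rightarrow> real \<Rightarrow> real"
  where "flat_exp j x = (if x > 0 then inverse x ^ j * exp (- inverse x) else 0)"

lemma flat_exp_tendsto_0: "((\<lambda>x. inverse x ^ j * exp (- inverse x)) \<longlongrightarrow> 0) (at_right (0::real))"
proof -
  have "((\<lambda>y::real. y ^ j / exp y) \<longlongrightarrow> 0) at_top"
    by (rule tendsto_power_div_exp_0)
  then have "((\<lambda>x::real. inverse x ^ j / exp (inverse x)) \<longlongrightarrow> 0) (at_right 0)"
    by (rule filterlim_compose[OF _ filterlim_inverse_at_top_right])
  then show ?thesis
    by (simp add: exp_minus divide_inverse)
qed

lemma DERIV_flat_exp:
  "(flat_exp j has_field_derivative flat_exp (j + 2) x - real j * flat_exp (j + 1) x) (at x)"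
proof (cases "x = 0")
  case False
  consider "x > 0" | "x < 0" using False by linarith
  then show ?thesis
  proof cases
    case 1
    have ev: "eventually (\<lambda>y. flat_exp j y = inverse y ^ j * exp (- inverse y)) (nhds x)"
      using eventually_nhds_in_open[of "{0<..}" x] 1
      by (auto simp: flat_exp_def elim: eventually_mono)
    have "((\<lambda>y. inverse y ^ j * exp (- inverse y)) has_field_derivative
      flat_exp (j + 2) x - real j * flat_exp (j + 1) x) (at x)"
    proof (cases j)
      case 0
      then show ?thesis using 1
        by (auto intro!: derivative_eq_intros simp: flat_exp_def power2_eq_square)
    next
      case (Suc l)
      show ?thesis
        using 1 unfolding Suc
        by (auto intro!: derivative_eq_intros simp: flat_exp_def power2_eq_square algebra_simps)
          (cases l; simp)
    qed
    then show ?thesis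
      using DERIV_cong_ev[OF refl ev refl] by blast
  next
    case 2
    have ev: "eventually (\<lambda>y. flat_exp j y = 0) (nhds x)"
      using eventually_nhds_in_open[of "{..<0}" x] 2
      by (auto simp: flat_exp_def elim: eventually_mono)
    have "flat_exp (j + 2) x - real j * flat_exp (j + 1) x = 0"
      using 2 by (simp add: flat_exp_def)
    moreover have "(flat_exp j has_field_derivative 0) (at x)"
      unfolding DERIV_cong_ev[OF refl ev refl] by (rule DERIV_const)
    ultimately show ?thesis
      by (simp only:)
  qed
next
  case True
  have "((\<lambda>y. flat_exp j y / y) \<longlongrightarrow> 0) (at 0)"
  proof (rule filterlim_split_at)
    have "\<forall>\<^sub>F y in at_left 0. flat_exp j y / y = 0"
      by (auto simp: eventually_at_filter flat_exp_def)
    then show "((\<lambda>y. flat_exp j y / y) \<longlongrightarrow> 0) (at_left 0)"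
      by (simp add: tendsto_eventually)
    have "\<forall>\<^sub>F y in at_right 0. inverse y ^ (j + 1) * exp (- inverse y) = flat_exp j y / y"
      by (auto simp: eventually_at_filter flat_exp_def divide_inverse)
    from Lim_transform_eventually[OF flat_exp_tendsto_0 this]
    show "((\<lambda>y. flat_exp j y / y) \<longlongrightarrow> 0) (at_right 0)" .
  qed
  then show ?thesis
    using True by (simp add: has_field_derivative_iff flat_exp_def)
qed

lemma continuous_flat_exp: "continuous_on S (flat_exp j)"
  by (meson DERIV_flat_exp DERIV_isCont continuous_at_imp_continuous_on)

lemma flat_exp_pos: "x > 0 \<Longrightarrow> flat_exp j x > 0"
  by (simp add: flat_exp_def)

lemma Ck_on_flat_exp:
  assumes W: "openin (Euclidean_space n) W"
  shows "Ck_on k n W f \<Longrightarrow> Ck_on k n W (\<lambda>x. flat_exp j (f x))"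
proof (induction k arbitrary: j)
  case 0
  then show ?case
    by (auto intro: continuous_on_compose2[OF continuous_flat_exp[of UNIV]])
next
  case (Suc k)
  show ?case
  proof (rule Ck_on_SucI'[OF W])
    show "continuous_on W (\<lambda>x. flat_exp j (f x))"
      using Ck_on_imp_continuous[OF Suc.prems]
      by (auto intro: continuous_on_compose2[OF continuous_flat_exp[of UNIV]])
    show "((\<lambda>t. flat_exp j (f (x(i := t)))) has_field_derivative
        (flat_exp (j + 2) (f x) + (- real j) * flat_exp (j + 1) (f x)) * partial i f x) (at (x i))"
      if "i < n" "x \<in> W" for i x
      using DERIV_chain2[OF DERIV_flat_exp Ck_on_Suc_D[OF Suc.prems that], of j]
      by (simp only: fun_upd_triv mult_minus_left diff_conv_add_uminus)
    have f: "Ck_on k n W f"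
      using Suc.prems Ck_on_decrease by blast
    show "Ck_on k n W
        (\<lambda>x. (flat_exp (j + 2) (f x) + (- real j) * flat_exp (j + 1) (f x)) * partial i f x)"
      if "i < n" for i
      using Suc.prems that
      by (intro Ck_on_mult[OF W] Ck_on_add[OF W] Ck_on_const[OF W] Suc.IH[OF f]) auto
  qed
qed

section \<open>Smooth functions and bump functions on a manifold\<close>

lemma Ck_on_subset: "Ck_on k n W f \<Longrightarrow> W' \<subseteq> W \<Longrightarrow> Ck_on k n W' f"
  by (induction k arbitrary: f) (auto intro: continuous_on_subset)

lemma Euclidean_box_in_open:
  assumes S: "open (S :: (nat \<Rightarrow> real) set)" "a \<in> S"
  shows "\<exists>\<epsilon>>0. \<forall>x. (\<forall>i<n. \<bar>x i - a i\<bar> \<le> \<epsilon>) \<longrightarrow> (\<forall>i\<ge>n. x i = a i) \<longrightarrow> x \<in> S"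
proof -
  have "openin (product_topology (\<lambda>i. euclideanreal) UNIV) S"
    using S(1) by (simp add: euclidean_product_topology)
  then obtain X where X: "a \<in> Pi\<^sub>E UNIV X" "\<And>i. open (X i)" "Pi\<^sub>E UNIV X \<subseteq> S"
    using product_topology_open_contains_basis[OF _ S(2), of "\<lambda>i. euclideanreal" UNIV] by auto
  have "\<exists>e>0. \<forall>y. \<bar>y - a i\<bar> < e \<longrightarrow> y \<in> X i" for i
    using X(1,2) open_real[of "X i"] by (auto simp: PiE_iff)
  then obtain e where e: "\<And>i. e i > 0" "\<And>i y. \<bar>y - a i\<bar> < e i \<Longrightarrow> y \<in> X i"
    by metis
  define \<epsilon> where "\<epsilon> = Min (insert 1 (e ` {..<n})) / 2"
  have \<epsilon>: "\<epsilon> > 0" "\<And>i. i < n \<Longrightarrow> \<epsilon> < e i"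
  proof -
    have "Min (insert 1 (e ` {..<n})) > 0"
      using e(1) by (subst Min_gr_iff) auto
    then show "\<epsilon> > 0"
      by (simp add: \<epsilon>_def)
    show "\<epsilon> < e i" if "i < n" for i
    proof -
      have "Min (insert 1 (e ` {..<n})) \<le> e i"
        using that by (intro Min_le) auto
      moreover have "\<epsilon> < Min (insert 1 (e ` {..<n}))"
        using \<open>\<epsilon> > 0\<close> unfolding \<epsilon>_def by linarith
      ultimately show ?thesis
        by linarith
    qed
  qed
  have "x \<in> S" if "\<forall>i<n. \<bar>x i - a i\<bar> \<le> \<epsilon>" "\<forall>i\<ge>n. x i = a i" for x
  proof -
    have "x i \<in> X i" for i
    proof (cases "i < n")
      case True
      then show ?thesis
        using that(1) \<epsilon>(2) e(2) by (meson le_less_trans)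
    next
      case False
      then have "x i = a i"
        using that(2) by auto
      then show ?thesis
        using X(1) by (simp add: PiE_iff)
    qed
    then show ?thesis
      using X(3) by auto
  qed
  then show ?thesis
    using \<epsilon>(1) by blast
qed

lemma compact_Euclidean_box:
  "compact {x :: nat \<Rightarrow> real. (\<forall>i<n. \<bar>x i - a i\<bar> \<le> \<epsilon>) \<and> (\<forall>i\<ge>n. x i = 0)}"
proof -
  let ?Y = "\<lambda>i. if i < n then cball (a i) \<epsilon> else {0}"
  have "compactin (product_topology (\<lambda>i. euclideanreal) UNIV) (Pi\<^sub>E UNIV ?Y)"
    by (subst compactin_PiE) auto
  then have "compact (Pi\<^sub>E UNIV ?Y)"
    by (simp add: euclidean_product_topology)
  moreover have "Pi\<^sub>E UNIV ?Y = {x. (\<forall>i<n. \<bar>x i - a i\<bar> \<le> \<epsilon>) \<and> (\<forall>i\<ge>n. x i = 0)}"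
  proof (intro equalityI subsetI)
    fix x assume x: "x \<in> Pi\<^sub>E UNIV ?Y"
    then have "x i \<in> ?Y i" for i
      by (auto simp: PiE_iff)
    then have "(i < n \<longrightarrow> dist (a i) (x i) \<le> \<epsilon>) \<and> (i \<ge> n \<longrightarrow> x i = 0)" for i
      by (metis (full_types) linorder_not_less mem_cball singletonD)
    then show "x \<in> {x. (\<forall>i<n. \<bar>x i - a i\<bar> \<le> \<epsilon>) \<and> (\<forall>i\<ge>n. x i = 0)}"
      by (simp add: dist_real_def abs_minus_commute)
  qed (auto simp: PiE_iff dist_real_def abs_minus_commute)
  ultimately show ?thesis
    by simp
qed

context smooth_manifold
begin

lemma chart_image_open_Int:
  assumes c: "(V, \<phi>) \<in> A" and "open U"
  shows "openin (Euclidean_space n) (\<phi> ` (U \<inter> V))"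
proof -
  have "openin (top_of_set V) (U \<inter> V)"
    using \<open>open U\<close> by (auto simp: openin_open)
  then have "openin (top_of_set (\<phi> ` V)) (\<phi> ` (U \<inter> V))"
    using homeomorphism_imp_open_map[OF chart_homeomorphism[OF c]] by blast
  then obtain S where S: "open S" "\<phi> ` (U \<inter> V) = \<phi> ` V \<inter> S"
    by (auto simp: openin_open)
  obtain S' where "open S'" "\<phi> ` V = S' \<inter> {x. \<forall>i\<ge>n. x i = 0}"
    using chart_image_open[OF c] openin_Euclidean_space_iff by blast
  then show ?thesis
    unfolding openin_Euclidean_space_iff using S by (intro exI[of _ "S \<inter> S'"]) auto
qed

lemma chart_inv: "(V, \<phi>) \<in> A \<Longrightarrow> p \<in> V \<Longrightarrow> inv_into V \<phi> (\<phi> p) = p"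
  using chart_homeomorphism homeomorphism_apply1 by metis

lemma smooth_onI:
  assumes "\<And>V \<phi> k. (V, \<phi>) \<in> A \<Longrightarrow> Ck_on k n (\<phi> ` (U \<inter> V)) (\<lambda>x. f (inv_into V \<phi> x))"
  shows "smooth_on U f"
  using assms by (auto simp: smooth_on_def Cinf_on_def)

lemma smooth_onD:
  assumes "smooth_on U f" "(V, \<phi>) \<in> A"
  shows "Ck_on k n (\<phi> ` (U \<inter> V)) (\<lambda>x. f (inv_into V \<phi> x))"
  using assms by (auto simp: smooth_on_def Cinf_on_def)

lemma smooth_on_subset: "smooth_on U f \<Longrightarrow> U' \<subseteq> U \<Longrightarrow> smooth_on U' f"
  by (rule smooth_onI, erule Ck_on_subset[OF smooth_onD]) auto

lemma smooth_on_cong: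
  assumes U: "open U" and f: "smooth_on U f" and eq: "\<And>p. p \<in> U \<Longrightarrow> f p = h p"
  shows "smooth_on U h"
proof (rule smooth_onI)
  fix V \<phi> k
  assume c: "(V, \<phi>) \<in> A"
  show "Ck_on k n (\<phi> ` (U \<inter> V)) (\<lambda>x. h (inv_into V \<phi> x))"
    by (rule Ck_on_cong[OF chart_image_open_Int[OF c U] _ smooth_onD[OF f c]])
      (use eq in \<open>auto simp: chart_inv[OF c]\<close>)
qed

lemma smooth_on_const: "open U \<Longrightarrow> smooth_on U (\<lambda>p. c)"
  by (rule smooth_onI, rule Ck_on_const, rule chart_image_open_Int)

lemma smooth_on_add:
  "open U \<Longrightarrow> smooth_on U f \<Longrightarrow> smooth_on U h \<Longrightarrow> smooth_on U (\<lambda>p. f p + h p)"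
  by (rule smooth_onI, rule Ck_on_add) (auto intro: chart_image_open_Int smooth_onD)

lemma smooth_on_mult:
  "open U \<Longrightarrow> smooth_on U f \<Longrightarrow> smooth_on U h \<Longrightarrow> smooth_on U (\<lambda>p. f p * h p)"
  by (rule smooth_onI, rule Ck_on_mult) (auto intro: chart_image_open_Int smooth_onD)

lemma smooth_on_flat_exp:
  "open U \<Longrightarrow> smooth_on U f \<Longrightarrow> smooth_on U (\<lambda>p. flat_exp j (f p))"
  by (rule smooth_onI, rule Ck_on_flat_exp) (auto intro: chart_image_open_Int smooth_onD)

lemma smooth_on_diff:
  assumes "open U" "smooth_on U f" "smooth_on U h"
  shows "smooth_on U (\<lambda>p. f p - h p)"
  using smooth_on_add[OF assms(1,2) smooth_on_mult[OF assms(1) smooth_on_const assms(3), of "- 1"]]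
    assms(1) by simp

lemma smooth_on_sum:
  assumes "open U" "finite I" "\<And>i. i \<in> I \<Longrightarrow> smooth_on U (f i)"
  shows "smooth_on U (\<lambda>p. \<Sum>i\<in>I. f i p)"
  using assms(2,3) by (induction I) (auto intro: smooth_on_const smooth_on_add assms(1))

lemma smooth_on_local:
  assumes U: "open U"
    and loc: "\<And>p. p \<in> U \<Longrightarrow> \<exists>U'. open U' \<and> p \<in> U' \<and> U' \<subseteq> U \<and> smooth_on U' f"
  shows "smooth_on U f"
proof (rule smooth_onI)
  fix V \<phi> k
  assume c: "(V, \<phi>) \<in> A"
  show "Ck_on k n (\<phi> ` (U \<inter> V)) (\<lambda>x. f (inv_into V \<phi> x))"
  proof (rule Ck_on_local[OF chart_image_open_Int[OF c U]])
    fix x assume "x \<in> \<phi> ` (U \<inter> V)"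
    then obtain p where p: "p \<in> U" "p \<in> V" "x = \<phi> p" by auto
    obtain U' where "open U'" "p \<in> U'" "U' \<subseteq> U" "smooth_on U' f"
      using loc[OF p(1)] by blast
    then show "\<exists>W'. openin (Euclidean_space n) W' \<and> x \<in> W' \<and> W' \<subseteq> \<phi> ` (U \<inter> V) \<and>
        Ck_on k n W' (\<lambda>x. f (inv_into V \<phi> x))"
      using p by (intro exI[of _ "\<phi> ` (U' \<inter> V)"])
        (auto intro: chart_image_open_Int[OF c] smooth_onD[OF _ c])
  qed
qed

lemma smooth_on_Un:
  assumes "open U" "open U'" "smooth_on U f" "smooth_on U' f"
  shows "smooth_on (U \<union> U') f"
  by (rule smooth_on_local) (use assms in auto)

lemma smooth_on_chart:
  assumes c: "(V, \<phi>) \<in> A" and i: "i < n"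
  shows "smooth_on V (\<lambda>p. \<phi> p i)"
proof (rule smooth_onI)
  fix V' \<phi>' k
  assume "(V', \<phi>') \<in> A"
  from chart_transition[OF this c i]
  show "Ck_on k n (\<phi>' ` (V \<inter> V')) (\<lambda>x. \<phi> (inv_into V' \<phi>' x) i)"
    by (simp add: Cinf_on_def Int_commute)
qed

text \<open>In the chart the bump function is \<open>flat_exp 0 (\<epsilon>\<^sup>2 - |x - a|\<^sup>2)\<close>, up to a constant factor. Its
  support is closed in the whole manifold because it is compact and the manifold is Hausdorff.\<close>

lemma bump_function:
  assumes "open V'" "p \<in> V'"
  obtains \<eta> K where "smooth \<eta>" "\<eta> p = 1" "closed K" "K \<subseteq> V'" "\<And>q. q \<notin> K \<Longrightarrow> \<eta> q = 0"
proof -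
  have "p \<in> (\<Union>(V, \<phi>)\<in>A. V)"
    unfolding chart_cover ..
  then obtain V \<phi> where c: "(V, \<phi>) \<in> A" and pV: "p \<in> V"
    by blast
  note V = chart_open[OF c]
  define a where "a = \<phi> p"
  have "openin (Euclidean_space n) (\<phi> ` (V' \<inter> V))"
    by (rule chart_image_open_Int[OF c assms(1)])
  then obtain S where S: "open S" "\<phi> ` (V' \<inter> V) = S \<inter> {x. \<forall>i\<ge>n. x i = 0}"
    using openin_Euclidean_space_iff by blast
  have a: "a \<in> S" "\<And>i. i \<ge> n \<Longrightarrow> a i = 0"
    using S(2) assms(2) pV by (auto simp: a_def)
  obtain \<epsilon> where \<epsilon>: "\<epsilon> > 0"
    "\<And>x. (\<forall>i<n. \<bar>x i - a i\<bar> \<le> \<epsilon>) \<Longrightarrow> (\<forall>i\<ge>n. x i = a i) \<Longrightarrow> x \<in> S"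
    using Euclidean_box_in_open[OF S(1) a(1)] by blast
  define K0 where "K0 = {x. (\<forall>i<n. \<bar>x i - a i\<bar> \<le> \<epsilon>) \<and> (\<forall>i\<ge>n. x i = 0)}"
  have K0: "K0 \<subseteq> \<phi> ` (V' \<inter> V)"
    unfolding S(2) K0_def using \<epsilon>(2) a(2) by auto
  define K where "K = inv_into V \<phi> ` K0"
  have "continuous_on K0 (inv_into V \<phi>)"
    using homeomorphism_cont2[OF chart_homeomorphism[OF c]] K0
    by (auto intro: continuous_on_subset)
  then have "compact K"
    unfolding K_def K0_def by (intro compact_continuous_image compact_Euclidean_box)
  then have K: "closed K"
    by (rule compact_imp_closed)
  have KV: "K \<subseteq> V' \<inter> V"
    using K0 unfolding K_def by (auto simp: chart_inv[OF c])
  define f where "f q = (if q \<in> V then flat_exp 0 (\<epsilon>\<^sup>2 - (\<Sum>i<n. (\<phi> q i - a i)\<^sup>2)) else 0)" for q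
  have f0: "f q = 0" if q: "q \<notin> K" for q
  proof (cases "q \<in> V")
    case True
    have "\<not> (\<Sum>i<n. (\<phi> q i - a i)\<^sup>2) < \<epsilon>\<^sup>2"
    proof
      assume *: "(\<Sum>i<n. (\<phi> q i - a i)\<^sup>2) < \<epsilon>\<^sup>2"
      have "\<bar>\<phi> q i - a i\<bar> \<le> \<epsilon>" if "i < n" for i
      proof -
        have "(\<phi> q i - a i)\<^sup>2 \<le> (\<Sum>i<n. (\<phi> q i - a i)\<^sup>2)"
          using that by (intro member_le_sum) auto
        then have "\<bar>\<phi> q i - a i\<bar>\<^sup>2 \<le> \<epsilon>\<^sup>2"
          using * by simp
        then show ?thesis
          using \<epsilon>(1) by (simp add: power2_le_iff_abs_le)
      qed
      moreover have "\<phi> q i = 0" if "i \<ge> n" for i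
        using chart_image_open[OF c] True that
        by (auto dest!: openin_subset simp: topspace_Euclidean_space)
      ultimately have "\<phi> q \<in> K0"
        by (auto simp: K0_def)
      then have "q \<in> K"
        unfolding K_def using chart_inv[OF c True] by force
      then show False
        using q by simp
    qed
    then show ?thesis
      by (simp add: f_def flat_exp_def)
  qed (simp add: f_def)
  have "smooth_on V f"
  proof (rule smooth_on_cong[OF V])
    show "smooth_on V (\<lambda>q. flat_exp 0 (\<epsilon>\<^sup>2 - (\<Sum>i<n. (\<phi> q i - a i) * (\<phi> q i - a i))))"
      by (intro smooth_on_flat_exp smooth_on_diff smooth_on_const smooth_on_sum smooth_on_mult
          smooth_on_chart c V) auto
  qed (simp add: f_def power2_eq_square)
  moreover have "smooth_on (- K) f"
    by (rule smooth_on_cong[OF _ smooth_on_const[of _ 0]]) (use K f0 in auto)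
  moreover have "V \<union> - K = UNIV"
    using KV by auto
  ultimately have f: "smooth f"
    using smooth_on_Un[OF V, of "- K"] K by (metis open_Compl)
  have fp: "f p > 0"
    using pV \<epsilon>(1) by (simp add: f_def a_def flat_exp_pos)
  show thesis
  proof
    show "smooth (\<lambda>q. inverse (f p) * f q)"
      by (intro smooth_on_mult smooth_on_const f open_UNIV)
  qed (use fp K KV f0 in auto)
qed

text \<open>Multiplication by a function with closed support in \<open>U\<close> turns a smooth function on \<open>U\<close>
  into a global one.\<close>

lemma smooth_cutoff:
  assumes U: "open U" and f: "smooth_on U f" and \<eta>: "smooth \<eta>"
    and K: "closed K" "K \<subseteq> U" "\<And>q. q \<notin> K \<Longrightarrow> \<eta> q = 0"
  shows "smooth (\<lambda>q. if q \<in> U then \<eta> q * f q else 0)" (is "smooth ?h")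
proof -
  have "smooth_on U ?h"
    by (rule smooth_on_cong[OF U smooth_on_mult[OF U smooth_on_subset[OF \<eta>] f]]) auto
  moreover have "smooth_on (- K) ?h"
    by (rule smooth_on_cong[OF _ smooth_on_const[of _ 0]]) (use K in auto)
  moreover have "U \<union> - K = UNIV"
    using K(2) by auto
  ultimately show ?thesis
    using smooth_on_Un[OF U, of "- K"] K(1) by (metis open_Compl)
qed

end

section \<open>Global sections of a vector bundle\<close>

context vector_bundle
begin

lemma triv_sum:
  assumes c: "(V, \<psi>) \<in> B" "p \<in> V" and "finite I" and u: "\<And>j. j \<in> I \<Longrightarrow> u j \<in> fib p"
  shows "\<psi> p (\<Sum>j\<in>I. a j *\<^sub>R u j) i = (\<Sum>j\<in>I. a j * \<psi> p (u j) i)"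
  using \<open>finite I\<close> u
proof (induction I)
  case empty
  have "0 \<in> fib p"
    by (rule subspace_0[OF fibre_subspace])
  from triv_linear[OF c this this, of 0 0 i] show ?case
    by simp
next
  case (insert j I)
  have "(\<Sum>j\<in>I. a j *\<^sub>R u j) \<in> fib p"
    using insert.prems by (intro subspace_sum subspace_scale fibre_subspace) auto
  from triv_linear[OF c insert.prems[OF insertI1] this, of "a j" 1 i]
  show ?case
    using insert by simp
qed

lemma triv_zero: "(V, \<psi>) \<in> B \<Longrightarrow> p \<in> V \<Longrightarrow> \<psi> p 0 i = 0"
  using triv_sum[of V \<psi> p "{}"] by simp

lemma triv_scale: "(V, \<psi>) \<in> B \<Longrightarrow> p \<in> V \<Longrightarrow> u \<in> fib p \<Longrightarrow> \<psi> p (a *\<^sub>R u) i = a * \<psi> p u i"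
  using triv_sum[of V \<psi> p "{()}" "\<lambda>_. u" "\<lambda>_. a"] by simp

lemma triv_inj:
  assumes c: "(V, \<psi>) \<in> B" "p \<in> V" and u: "u \<in> fib p" "v \<in> fib p"
    and eq: "\<And>i. i < r \<Longrightarrow> \<psi> p u i = \<psi> p v i"
  shows "u = v"
proof -
  have b: "bij_betw (\<psi> p) (fib p) (topspace (Euclidean_space r))"
    by (rule triv_bij[OF c])
  have "\<psi> p u i = \<psi> p v i" for i
  proof (cases "i < r")
    case False
    then show ?thesis
      using bij_betwE[OF b] u by (auto simp: topspace_Euclidean_space)
  qed (rule eq)
  then show ?thesis
    using bij_betw_imp_inj_on[OF b] u by (auto dest: inj_onD)
qed

lemma sectionsI:
  assumes "\<And>p. p \<in> U \<Longrightarrow> s p \<in> fib p"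
    and "\<And>V \<psi> i. (V, \<psi>) \<in> B \<Longrightarrow> i < r \<Longrightarrow> smooth_on (U \<inter> V) (\<lambda>p. \<psi> p (s p) i)"
  shows "s \<in> sections U"
  using assms by (auto simp: sections_def)

lemma sections_fib: "s \<in> sections U \<Longrightarrow> p \<in> U \<Longrightarrow> s p \<in> fib p"
  by (auto simp: sections_def)

lemma Gam_fib: "s \<in> Gam \<Longrightarrow> s p \<in> fib p"
  by (rule sections_fib) auto

lemma sections_smooth:
  "s \<in> sections U \<Longrightarrow> (V, \<psi>) \<in> B \<Longrightarrow> i < r \<Longrightarrow> smooth_on (U \<inter> V) (\<lambda>p. \<psi> p (s p) i)"
  by (auto simp: sections_def)

lemma sections_zero: "open U \<Longrightarrow> (\<lambda>p. 0) \<in> sections U"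
proof (rule sectionsI)
  show "smooth_on (U \<inter> V) (\<lambda>p. \<psi> p 0 i)" if "open U" "(V, \<psi>) \<in> B" for V \<psi> i
    by (rule smooth_on_cong[OF _ smooth_on_const[of _ 0]])
      (use that triv_open in \<open>auto simp: triv_zero\<close>)
qed (rule subspace_0[OF fibre_subspace])

lemma sections_add:
  assumes U: "open U" and s: "s \<in> sections U" and t: "t \<in> sections U"
  shows "(\<lambda>p. s p + t p) \<in> sections U"
proof (rule sectionsI)
  show "s p + t p \<in> fib p" if "p \<in> U" for p
    using sections_fib[OF s that] sections_fib[OF t that] by (rule subspace_add[OF fibre_subspace])
  show "smooth_on (U \<inter> V) (\<lambda>p. \<psi> p (s p + t p) i)" if c: "(V, \<psi>) \<in> B" and "i < r" for V \<psi> i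
  proof (rule smooth_on_cong)
    show "open (U \<inter> V)"
      using U triv_open[OF c] by auto
    then show "smooth_on (U \<inter> V) (\<lambda>p. \<psi> p (s p) i + \<psi> p (t p) i)"
      by (intro smooth_on_add sections_smooth s t c that)
    show "\<psi> p (s p) i + \<psi> p (t p) i = \<psi> p (s p + t p) i" if "p \<in> U \<inter> V" for p
      using triv_linear[OF c _ sections_fib[OF s] sections_fib[OF t], of p 1 1 i] that by auto
  qed
qed

lemma sections_scale:
  assumes U: "open U" and f: "smooth_on U f" and s: "s \<in> sections U"
  shows "(\<lambda>p. f p *\<^sub>R s p) \<in> sections U"
proof (rule sectionsI)
  show "f p *\<^sub>R s p \<in> fib p" if "p \<in> U" for p
    using sections_fib[OF s that] by (rule subspace_scale[OF fibre_subspace])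
  show "smooth_on (U \<inter> V) (\<lambda>p. \<psi> p (f p *\<^sub>R s p) i)" if c: "(V, \<psi>) \<in> B" and "i < r" for V \<psi> i
  proof (rule smooth_on_cong)
    show "open (U \<inter> V)"
      using U triv_open[OF c] by auto
    then show "smooth_on (U \<inter> V) (\<lambda>p. f p * \<psi> p (s p) i)"
      by (intro smooth_on_mult sections_smooth s c that smooth_on_subset[OF f]) auto
    show "f p * \<psi> p (s p) i = \<psi> p (f p *\<^sub>R s p) i" if "p \<in> U \<inter> V" for p
      using triv_scale[OF c _ sections_fib[OF s], of p] that by auto
  qed
qed

lemma Gam_add: "s \<in> Gam \<Longrightarrow> t \<in> Gam \<Longrightarrow> (\<lambda>p. s p + t p) \<in> Gam"
  by (rule sections_add) auto

lemma Gam_scale: "smooth f \<Longrightarrow> s \<in> Gam \<Longrightarrow> (\<lambda>p. f p *\<^sub>R s p) \<in> Gam"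
  by (rule sections_scale) auto

lemma Gam_scale_const: "s \<in> Gam \<Longrightarrow> (\<lambda>p. c *\<^sub>R s p) \<in> Gam"
  by (intro Gam_scale smooth_on_const) auto

lemma Gam_diff: "s \<in> Gam \<Longrightarrow> t \<in> Gam \<Longrightarrow> (\<lambda>p. s p - t p) \<in> Gam"
  using Gam_add[OF _ Gam_scale_const[of t "- 1"], of s] by simp

lemma Gam_sum:
  "finite I \<Longrightarrow> (\<And>j. j \<in> I \<Longrightarrow> s j \<in> Gam) \<Longrightarrow> (\<lambda>p. \<Sum>j\<in>I. s j p) \<in> Gam"
  by (induction I rule: finite_induct) (auto intro: Gam_add sections_zero)

lemma section_cutoff:
  assumes U: "open U" and s: "s \<in> sections U" and \<eta>: "smooth \<eta>"
    and K: "closed K" "K \<subseteq> U" "\<And>q. q \<notin> K \<Longrightarrow> \<eta> q = 0"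
  shows "(\<lambda>q. if q \<in> U then \<eta> q *\<^sub>R s q else 0) \<in> Gam"
proof (rule sectionsI)
  show "(if p \<in> U then \<eta> p *\<^sub>R s p else 0) \<in> fib p" for p
    using sections_fib[OF s] by (auto intro: subspace_scale subspace_0 fibre_subspace)
  fix V \<psi> i assume c: "(V, \<psi>) \<in> B" and i: "i < r"
  note V = triv_open[OF c]
  let ?h = "\<lambda>p. \<psi> p (if p \<in> U then \<eta> p *\<^sub>R s p else 0) i"
  have "smooth_on (U \<inter> V) ?h"
  proof (rule smooth_on_cong)
    show "smooth_on (U \<inter> V) (\<lambda>p. \<eta> p * \<psi> p (s p) i)"
      using U V
      by (intro smooth_on_mult sections_smooth s c i smooth_on_subset[OF \<eta>]) auto
  qed (use U V triv_scale[OF c _ sections_fib[OF s]] in auto)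
  moreover have "smooth_on (- K \<inter> V) ?h"
    by (rule smooth_on_cong[OF _ smooth_on_const[of _ 0]])
      (use K V in \<open>auto simp: triv_zero[OF c]\<close>)
  moreover have "(U \<inter> V) \<union> (- K \<inter> V) = UNIV \<inter> V"
    using K(2) by auto
  ultimately show "smooth_on (UNIV \<inter> V) ?h"
    using smooth_on_Un[of "U \<inter> V" "- K \<inter> V"] U V K(1) by (metis open_Compl open_Int)
qed

text \<open>The local frame that corresponds to the standard basis in a local trivialization.\<close>

definition triv_frame :: "('p \<Rightarrow> 'v \<Rightarrow> nat \<Rightarrow> real) \<Rightarrow> nat \<Rightarrow> 'p \<Rightarrow> 'v"
  where "triv_frame \<psi> j q = inv_into (fib q) (\<psi> q) (\<lambda>l. if l = j then 1 else 0)"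

context
  fixes V \<psi>
  assumes c: "(V, \<psi>) \<in> B"
begin

lemma unit_in_topspace: "j < r \<Longrightarrow> (\<lambda>l. if l = j then 1 else 0) \<in> topspace (Euclidean_space r)"
  by (auto simp: topspace_Euclidean_space)

lemma triv_frame_fib:
  assumes "q \<in> V" "j < r"
  shows "triv_frame \<psi> j q \<in> fib q"
  using bij_betw_imp_surj_on[OF triv_bij[OF c assms(1)]] unit_in_topspace[OF assms(2)]
  unfolding triv_frame_def by (metis inv_into_into)

lemma triv_triv_frame:
  assumes "q \<in> V" "j < r"
  shows "\<psi> q (triv_frame \<psi> j q) i = (if i = j then 1 else 0)"
  using bij_betw_inv_into_right[OF triv_bij[OF c assms(1)] unit_in_topspace[OF assms(2)]]
  by (auto simp: triv_frame_def)

lemma triv_frame_sections: "j < r \<Longrightarrow> triv_frame \<psi> j \<in> sections V"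
  unfolding triv_frame_def
  by (rule sectionsI)
    (use triv_frame_fib triv_transition[OF c] in \<open>auto simp: triv_frame_def\<close>)

lemma triv_frame_decompose:
  assumes q: "q \<in> V" and u: "u \<in> fib q"
  shows "u = (\<Sum>j<r. \<psi> q u j *\<^sub>R triv_frame \<psi> j q)"
proof (rule triv_inj[OF c q u])
  show "(\<Sum>j<r. \<psi> q u j *\<^sub>R triv_frame \<psi> j q) \<in> fib q"
    by (intro subspace_sum subspace_scale fibre_subspace triv_frame_fib q) auto
  show "\<psi> q u i = \<psi> q (\<Sum>j<r. \<psi> q u j *\<^sub>R triv_frame \<psi> j q) i" if "i < r" for i
    using that
    by (subst triv_sum[OF c q]) (auto simp: triv_frame_fib q triv_triv_frame if_distrib cong: if_cong)
qed

end

lemma triv_around: obtains V \<psi> where "(V, \<psi>) \<in> B" "p \<in> V"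
proof -
  have "p \<in> (\<Union>(V, \<psi>)\<in>B. V)"
    unfolding triv_cover ..
  then show thesis
    using that by blast
qed

lemma section_through:
  assumes u: "u \<in> fib p"
  obtains s where "s \<in> Gam" "s p = u"
proof -
  obtain V \<psi> where c: "(V, \<psi>) \<in> B" and p: "p \<in> V"
    by (rule triv_around)
  note V = triv_open[OF c]
  obtain \<eta> K where \<eta>: "smooth \<eta>" "\<eta> p = 1" "closed K" "K \<subseteq> V" "\<And>q. q \<notin> K \<Longrightarrow> \<eta> q = 0"
    by (rule bump_function[OF V p]) blast
  define F where "F j q = (if q \<in> V then \<eta> q *\<^sub>R triv_frame \<psi> j q else 0)" for j q
  have F: "F j \<in> Gam" if "j < r" for j
    unfolding F_def by (rule section_cutoff[OF V triv_frame_sections[OF c that] \<eta>(1,3-)])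
  show thesis
  proof
    show "(\<lambda>q. \<Sum>j<r. \<psi> p u j *\<^sub>R F j q) \<in> Gam"
      by (intro Gam_sum Gam_scale_const F) auto
    show "(\<Sum>j<r. \<psi> p u j *\<^sub>R F j p) = u"
      using triv_frame_decompose[OF c p u] p \<eta>(2) by (simp add: F_def)
  qed
qed

text \<open>An operator on sections that is linear over the smooth functions at \<open>p\<close> only depends on
  the value of its argument at \<open>p\<close>. If \<open>\<eta>\<close> is a bump function at \<open>p\<close> with support in the domain of
  a local frame \<open>E\<^sub>j\<close> and \<open>s = \<Sum> s\<^sub>j E\<^sub>j\<close>, then \<open>\<eta>\<^sup>2 s = \<Sum> (\<eta> s\<^sub>j) (\<eta> E\<^sub>j)\<close> globally.\<close>

lemma tensorial_zero:
  assumes add: "\<And>s t. s \<in> Gam \<Longrightarrow> t \<in> Gam \<Longrightarrow> T (\<lambda>q. s q + t q) p = T s p + T t p"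
    and scale: "\<And>f s. smooth f \<Longrightarrow> s \<in> Gam \<Longrightarrow> T (\<lambda>q. f q *\<^sub>R s q) p = f p *\<^sub>R T s p"
    and s: "s \<in> Gam" "s p = 0"
  shows "T s p = (0 :: 'w::real_vector)"
proof -
  obtain V \<psi> where c: "(V, \<psi>) \<in> B" and p: "p \<in> V"
    by (rule triv_around)
  note V = triv_open[OF c]
  obtain \<eta> K where \<eta>: "smooth \<eta>" "\<eta> p = 1" "closed K" "K \<subseteq> V" "\<And>q. q \<notin> K \<Longrightarrow> \<eta> q = 0"
    by (rule bump_function[OF V p]) blast
  define F where "F j q = (if q \<in> V then \<eta> q *\<^sub>R triv_frame \<psi> j q else 0)" for j q
  define f where "f j q = (if q \<in> V then \<eta> q * \<psi> q (s q) j else 0)" for j q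
  have F: "F j \<in> Gam" if "j < r" for j
    unfolding F_def by (rule section_cutoff[OF V triv_frame_sections[OF c that] \<eta>(1,3-)])
  have f: "smooth (f j)" if "j < r" for j
    unfolding f_def
    by (rule smooth_cutoff[OF V _ \<eta>(1,3-)]) (use sections_smooth[OF s(1) c that] in auto)
  have eq: "(\<eta> q * \<eta> q) *\<^sub>R s q = (\<Sum>j<r. f j q *\<^sub>R F j q)" for q
  proof (cases "q \<in> V")
    case True
    have "(\<Sum>j<r. f j q *\<^sub>R F j q) = (\<eta> q * \<eta> q) *\<^sub>R (\<Sum>j<r. \<psi> q (s q) j *\<^sub>R triv_frame \<psi> j q)"
      using True by (simp add: f_def F_def scaleR_sum_right mult_ac)
    then show ?thesis
      using triv_frame_decompose[OF c True Gam_fib[OF s(1)]] by simp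
  next
    case False
    then show ?thesis
      using \<eta>(4,5) by (auto simp: f_def)
  qed
  have T0: "T (\<lambda>q. 0) p = 0"
    using add[of "\<lambda>q. 0" "\<lambda>q. 0"] by (simp add: sections_zero)
  have T_sum: "T (\<lambda>q. \<Sum>j\<in>I. f j q *\<^sub>R F j q) p = (\<Sum>j\<in>I. f j p *\<^sub>R T (F j) p)"
    if "finite I" "I \<subseteq> {..<r}" for I
    using that
  proof (induction I)
    case (insert j I)
    have "(\<lambda>q. f j q *\<^sub>R F j q) \<in> Gam" "(\<lambda>q. \<Sum>j\<in>I. f j q *\<^sub>R F j q) \<in> Gam"
      using insert.prems insert.hyps by (auto intro!: Gam_sum Gam_scale f F)
    from add[OF this] show ?case
      using insert scale[OF f F] by simp
  qed (simp add: T0)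
  have "T s p = T (\<lambda>q. (\<eta> q * \<eta> q) *\<^sub>R s q) p"
    using scale[OF smooth_on_mult[OF open_UNIV \<eta>(1) \<eta>(1)] s(1)] \<eta>(2) by simp
  also have "\<dots> = (\<Sum>j<r. f j p *\<^sub>R T (F j) p)"
    unfolding eq by (rule T_sum) auto
  also have "\<dots> = 0"
    using p s(2) by (simp add: f_def triv_zero[OF c])
  finally show ?thesis .
qed

lemma tensorial_eq:
  assumes add: "\<And>s t. s \<in> Gam \<Longrightarrow> t \<in> Gam \<Longrightarrow> T (\<lambda>q. s q + t q) p = T s p + T t p"
    and scale: "\<And>f s. smooth f \<Longrightarrow> s \<in> Gam \<Longrightarrow> T (\<lambda>q. f q *\<^sub>R s q) p = f p *\<^sub>R T s p"
    and s: "s \<in> Gam" "t \<in> Gam" "s p = t p"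
  shows "T s p = (T t p :: 'w::real_vector)"
proof -
  have "T (\<lambda>q. s q - t q) p = 0"
  proof (rule tensorial_zero[of T p])
    show "(\<lambda>q. s q - t q) \<in> Gam"
      by (rule Gam_diff[OF s(1,2)])
  qed (use s(3) in \<open>auto intro: add scale\<close>)
  moreover have "T s p = T (\<lambda>q. s q - t q) p + T t p"
    using add[OF Gam_diff[OF s(1,2)] s(2)] by (simp only: diff_add_cancel)
  ultimately show ?thesis
    by simp
qed

end

section \<open>Riemannian metrics on the fibres\<close>

context vector_bundle
begin

context
  fixes g
  assumes g: "riemannian_metric g"
begin

lemma metric_linear_left:
  assumes "u \<in> fib p" "v \<in> fib p" "w \<in> fib p"
  shows "g p (a *\<^sub>R u + b *\<^sub>R v) w = a * g p u w + b * g p v w"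
proof -
  have "\<forall>p a b. \<forall>u\<in>fib p. \<forall>v\<in>fib p. \<forall>w\<in>fib p.
      g p (a *\<^sub>R u + b *\<^sub>R v) w = a * g p u w + b * g p v w"
    using g unfolding riemannian_metric_def by (elim conjE)
  then show ?thesis
    using assms by simp
qed

lemma metric_sym:
  assumes "u \<in> fib p" "v \<in> fib p"
  shows "g p u v = g p v u"
proof -
  have "\<forall>p. \<forall>u\<in>fib p. \<forall>v\<in>fib p. g p u v = g p v u"
    using g unfolding riemannian_metric_def by (elim conjE)
  then show ?thesis
    using assms by blast
qed

lemma metric_pos:
  assumes "u \<in> fib p" "u \<noteq> 0"
  shows "g p u u > 0"
proof -
  have "\<forall>p. \<forall>u\<in>fib p. u \<noteq> 0 \<longrightarrow> g p u u > 0"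
    using g unfolding riemannian_metric_def by (elim conjE)
  then show ?thesis
    using assms by blast
qed

lemma metric_smooth:
  assumes "s \<in> Gam" "t \<in> Gam"
  shows "smooth (\<lambda>q. g q (s q) (t q))"
proof -
  have "\<forall>U. open U \<longrightarrow> (\<forall>s\<in>sections U. \<forall>t\<in>sections U. smooth_on U (\<lambda>p. g p (s p) (t p)))"
    using g unfolding riemannian_metric_def by (elim conjE)
  then show ?thesis
    using assms open_UNIV by blast
qed

lemma metric_linear_right:
  assumes "u \<in> fib p" "v \<in> fib p" "w \<in> fib p"
  shows "g p w (a *\<^sub>R u + b *\<^sub>R v) = a * g p w u + b * g p w v"
proof -
  have "a *\<^sub>R u + b *\<^sub>R v \<in> fib p"
    using assms by (intro subspace_add subspace_scale fibre_subspace)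
  then show ?thesis
    using metric_linear_left[OF assms] assms by (simp add: metric_sym[of w])
qed

lemma metric_diff:
  assumes "u \<in> fib p" "v \<in> fib p" "w \<in> fib p"
  shows "g p (u - v) w = g p u w - g p v w" "g p w (u - v) = g p w u - g p w v"
  using metric_linear_left[OF assms, of 1 "- 1"] metric_linear_right[OF assms, of 1 "- 1"]
  by simp_all

lemma metric_minus:
  assumes "u \<in> fib p" "w \<in> fib p"
  shows "g p (- u) w = - g p u w" "g p w (- u) = - g p w u"
  using metric_linear_left[OF assms(1,1,2), of "- 1" 0]
    metric_linear_right[OF assms(1,1,2), of "- 1" 0]
  by simp_all

lemma metric_sum_right:
  assumes "finite I" "\<And>i. i \<in> I \<Longrightarrow> u i \<in> fib p" "w \<in> fib p"
  shows "g p w (\<Sum>i\<in>I. a i *\<^sub>R u i) = (\<Sum>i\<in>I. a i * g p w (u i))"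
  using assms
proof (induction I)
  case empty
  then show ?case
    using metric_linear_right[of w p w w 0 0] by simp
next
  case (insert i I)
  have "(\<Sum>i\<in>I. a i *\<^sub>R u i) \<in> fib p"
    using insert.prems by (intro subspace_sum subspace_scale fibre_subspace) auto
  then show ?case
    using metric_linear_right[of "u i" p "\<Sum>i\<in>I. a i *\<^sub>R u i" w "a i" 1] insert by simp
qed

end

end

section \<open>Tensoriality of the curvature\<close>

context lie_algebroid
begin

text \<open>The derivative of a function along a section, by means of the anchor.\<close>

abbreviation anchor_deriv :: "('p \<Rightarrow> 'v) \<Rightarrow> ('p \<Rightarrow> real) \<Rightarrow> 'p \<Rightarrow> real"
  where "anchor_deriv s f \<equiv> \<lambda>q. \<rho> q (s q) f"

lemma smooth_anchor_deriv: "s \<in> Gam \<Longrightarrow> smooth f \<Longrightarrow> smooth (anchor_deriv s f)"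
  by (rule anchor_smooth) auto

lemma anchor_deriv_add:
  assumes "s \<in> Gam" "smooth f" "smooth h"
  shows "\<rho> p (s p) (\<lambda>q. f q + h q) = \<rho> p (s p) f + \<rho> p (s p) h"
proof -
  have "\<rho> p (s p) (\<lambda>q. 1 * f q + 1 * h q) = 1 * \<rho> p (s p) f + 1 * \<rho> p (s p) h"
    using anchor_tangent[OF Gam_fib[OF assms(1)], of p] assms(2,3)
    unfolding tangent_vector_def by blast
  then show ?thesis
    by simp
qed

lemma bracket_add_left:
  "s1 \<in> Gam \<Longrightarrow> s2 \<in> Gam \<Longrightarrow> t \<in> Gam \<Longrightarrow>
    br (\<lambda>p. s1 p + s2 p) t = (\<lambda>p. br s1 t p + br s2 t p)"
  using bracket_linear[of s1 s2 t 1 1] by simp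

lemma bracket_scale_left:
  assumes "s \<in> Gam" "t \<in> Gam" "smooth f"
  shows "br (\<lambda>p. f p *\<^sub>R s p) t = (\<lambda>p. f p *\<^sub>R br s t p + (- \<rho> p (t p) f) *\<^sub>R s p)"
proof -
  have "br (\<lambda>p. f p *\<^sub>R s p) t = (\<lambda>p. - br t (\<lambda>p. f p *\<^sub>R s p) p)"
    by (rule bracket_skew) (use assms Gam_scale in auto)
  also have "\<dots> = (\<lambda>p. - (f p *\<^sub>R br t s p + \<rho> p (t p) f *\<^sub>R s p))"
    unfolding bracket_leibniz[OF assms(2,1,3)] ..
  also have "\<dots> = (\<lambda>p. f p *\<^sub>R br s t p + (- \<rho> p (t p) f) *\<^sub>R s p)"
    unfolding bracket_skew[OF assms(1,2)] by (simp add: fun_eq_iff)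
  finally show ?thesis .
qed

context
  fixes nab
  assumes nab: "linear_connection nab"
begin

lemma nab_Gam: "s \<in> Gam \<Longrightarrow> t \<in> Gam \<Longrightarrow> nab s t \<in> Gam"
  using nab by (simp add: linear_connection_def)

lemma nab_linear_left: "s1 \<in> Gam \<Longrightarrow> s2 \<in> Gam \<Longrightarrow> t \<in> Gam \<Longrightarrow>
    nab (\<lambda>p. a *\<^sub>R s1 p + b *\<^sub>R s2 p) t = (\<lambda>p. a *\<^sub>R nab s1 t p + b *\<^sub>R nab s2 t p)"
  using nab unfolding linear_connection_def by blast

lemma nab_linear_right: "s1 \<in> Gam \<Longrightarrow> s2 \<in> Gam \<Longrightarrow> t \<in> Gam \<Longrightarrow>
    nab t (\<lambda>p. a *\<^sub>R s1 p + b *\<^sub>R s2 p) = (\<lambda>p. a *\<^sub>R nab t s1 p + b *\<^sub>R nab t s2 p)"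
  using nab unfolding linear_connection_def by blast

lemma nab_add_left: "s1 \<in> Gam \<Longrightarrow> s2 \<in> Gam \<Longrightarrow> t \<in> Gam \<Longrightarrow>
    nab (\<lambda>p. s1 p + s2 p) t = (\<lambda>p. nab s1 t p + nab s2 t p)"
  using nab_linear_left[of s1 s2 t 1 1] by simp

lemma nab_minus_left: "s \<in> Gam \<Longrightarrow> t \<in> Gam \<Longrightarrow> nab (\<lambda>p. - s p) t = (\<lambda>p. - nab s t p)"
  using nab_linear_left[of s s t "- 1" 0] by simp

lemma nab_add_right: "s1 \<in> Gam \<Longrightarrow> s2 \<in> Gam \<Longrightarrow> t \<in> Gam \<Longrightarrow>
    nab t (\<lambda>p. s1 p + s2 p) = (\<lambda>p. nab t s1 p + nab t s2 p)"
  using nab_linear_right[of s1 s2 t 1 1] by simp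

lemma nab_scale_left: "s \<in> Gam \<Longrightarrow> t \<in> Gam \<Longrightarrow> smooth f \<Longrightarrow>
    nab (\<lambda>p. f p *\<^sub>R s p) t = (\<lambda>p. f p *\<^sub>R nab s t p)"
  using nab unfolding linear_connection_def by blast

lemma nab_scale_right: "s \<in> Gam \<Longrightarrow> t \<in> Gam \<Longrightarrow> smooth f \<Longrightarrow>
    nab s (\<lambda>p. f p *\<^sub>R t p) = (\<lambda>p. \<rho> p (s p) f *\<^sub>R t p + f p *\<^sub>R nab s t p)"
  using nab unfolding linear_connection_def by blast

lemma curvature_Gam:
  "s1 \<in> Gam \<Longrightarrow> s2 \<in> Gam \<Longrightarrow> t \<in> Gam \<Longrightarrow> curvature br nab s1 s2 t \<in> Gam"
  unfolding curvature_def by (intro Gam_diff nab_Gam bracket_closed)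

lemma curvature_skew:
  assumes "s1 \<in> Gam" "s2 \<in> Gam" "t \<in> Gam"
  shows "curvature br nab s2 s1 t p = - curvature br nab s1 s2 t p"
proof -
  have "nab (br s2 s1) t = nab (\<lambda>p. - br s1 s2 p) t"
    using bracket_skew[OF assms(2,1)] by simp
  also have "\<dots> = (\<lambda>p. - nab (br s1 s2) t p)"
    using assms by (intro nab_minus_left bracket_closed)
  finally show ?thesis
    by (simp add: curvature_def)
qed

lemma curvature_add_left:
  assumes "s \<in> Gam" "s' \<in> Gam" "s2 \<in> Gam" "t \<in> Gam"
  shows "curvature br nab (\<lambda>q. s q + s' q) s2 t p =
    curvature br nab s s2 t p + curvature br nab s' s2 t p"
  using assms
  by (simp add: curvature_def nab_add_left nab_add_right bracket_add_left nab_Gam bracket_closed)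

lemma curvature_scale_left:
  assumes f: "smooth f" and s: "s \<in> Gam" "s2 \<in> Gam" and t: "t \<in> Gam"
  shows "curvature br nab (\<lambda>q. f q *\<^sub>R s q) s2 t p = f p *\<^sub>R curvature br nab s s2 t p"
proof -
  have D: "smooth (\<lambda>q. - \<rho> q (s2 q) f)"
    using smooth_on_mult[OF open_UNIV smooth_on_const[OF open_UNIV, of "- 1"]
        smooth_anchor_deriv[OF s(2) f]] by simp
  have "nab (br (\<lambda>q. f q *\<^sub>R s q) s2) t =
      nab (\<lambda>q. f q *\<^sub>R br s s2 q + (- \<rho> q (s2 q) f) *\<^sub>R s q) t"
    by (simp only: bracket_scale_left[OF s f])
  also have "\<dots> = (\<lambda>q. nab (\<lambda>q. f q *\<^sub>R br s s2 q) t q +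
      nab (\<lambda>q. (- \<rho> q (s2 q) f) *\<^sub>R s q) t q)"
    by (intro nab_add_left Gam_scale bracket_closed s t f D)
  also have "\<dots> = (\<lambda>q. f q *\<^sub>R nab (br s s2) t q + (- \<rho> q (s2 q) f) *\<^sub>R nab s t q)"
    by (simp only: nab_scale_left[OF bracket_closed[OF s] t f] nab_scale_left[OF s(1) t D])
  finally have b: "nab (br (\<lambda>q. f q *\<^sub>R s q) s2) t p =
      f p *\<^sub>R nab (br s s2) t p - \<rho> p (s2 p) f *\<^sub>R nab s t p"
    by simp
  show ?thesis
    unfolding curvature_def b
    by (simp add: nab_scale_left nab_scale_right nab_Gam s t f algebra_simps)
qed

lemma curvature_add_right:
  assumes "s1 \<in> Gam" "s2 \<in> Gam" "t \<in> Gam" "t' \<in> Gam"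
  shows "curvature br nab s1 s2 (\<lambda>q. t q + t' q) p =
    curvature br nab s1 s2 t p + curvature br nab s1 s2 t' p"
  using assms
  by (simp add: curvature_def nab_add_right nab_Gam bracket_closed)

lemma nab_nab_scale:
  assumes f: "smooth f" and s: "s1 \<in> Gam" "s2 \<in> Gam" and t: "t \<in> Gam"
  shows "nab s1 (nab s2 (\<lambda>q. f q *\<^sub>R t q)) p =
    \<rho> p (s1 p) (anchor_deriv s2 f) *\<^sub>R t p + \<rho> p (s2 p) f *\<^sub>R nab s1 t p +
    \<rho> p (s1 p) f *\<^sub>R nab s2 t p + f p *\<^sub>R nab s1 (nab s2 t) p"
proof -
  note D = smooth_anchor_deriv[OF s(2) f]
  have "nab s1 (nab s2 (\<lambda>q. f q *\<^sub>R t q)) =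
      nab s1 (\<lambda>q. \<rho> q (s2 q) f *\<^sub>R t q + f q *\<^sub>R nab s2 t q)"
    by (simp only: nab_scale_right[OF s(2) t f])
  also have "\<dots> = (\<lambda>q. nab s1 (\<lambda>q. \<rho> q (s2 q) f *\<^sub>R t q) q + nab s1 (\<lambda>q. f q *\<^sub>R nab s2 t q) q)"
    by (intro nab_add_right Gam_scale D t f nab_Gam s)
  also have "\<dots> = (\<lambda>q. (\<rho> q (s1 q) (anchor_deriv s2 f) *\<^sub>R t q + \<rho> q (s2 q) f *\<^sub>R nab s1 t q) +
      (\<rho> q (s1 q) f *\<^sub>R nab s2 t q + f q *\<^sub>R nab s1 (nab s2 t) q))"
    by (simp only: nab_scale_right[OF s(1) t D] nab_scale_right[OF s(1) nab_Gam[OF s(2) t] f])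
  finally show ?thesis
    by (simp add: add_ac)
qed

text \<open>The second derivatives of \<open>f\<close> cancel because the anchor is compatible with the brackets.\<close>

lemma curvature_scale_right:
  assumes f: "smooth f" and s: "s1 \<in> Gam" "s2 \<in> Gam" and t: "t \<in> Gam"
  shows "curvature br nab s1 s2 (\<lambda>q. f q *\<^sub>R t q) p = f p *\<^sub>R curvature br nab s1 s2 t p"
  unfolding curvature_def nab_nab_scale[OF f s t] nab_nab_scale[OF f s(2,1) t]
    nab_scale_right[OF bracket_closed[OF s] t f] anchor_bracket[OF s f]
  by (simp add: algebra_simps)

lemma curvature_tensorial:
  assumes s: "s1 \<in> Gam" "s2 \<in> Gam" "t \<in> Gam" and s': "s1' \<in> Gam" "s2' \<in> Gam" "t' \<in> Gam"
    and eq: "s1 p = s1' p" "s2 p = s2' p" "t p = t' p"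
  shows "curvature br nab s1 s2 t p = curvature br nab s1' s2' t' p"
proof -
  have 1: "curvature br nab s1 s t p = curvature br nab s1' s t p" if "s \<in> Gam" for s
    by (rule tensorial_eq[where T = "\<lambda>x. curvature br nab x s t"])
      (use s s' eq that in \<open>auto intro: curvature_add_left curvature_scale_left\<close>)
  have 2: "curvature br nab s2 s1' t p = curvature br nab s2' s1' t p"
    by (rule tensorial_eq[where T = "\<lambda>x. curvature br nab x s1' t"])
      (use s s' eq in \<open>auto intro: curvature_add_left curvature_scale_left\<close>)
  have 3: "curvature br nab s1' s2' t p = curvature br nab s1' s2' t' p"
    by (rule tensorial_eq[where T = "\<lambda>x. curvature br nab s1' s2' x"])
      (use s s' eq in \<open>auto intro: curvature_add_right curvature_scale_right\<close>)
  show ?thesis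
    using 1[OF s(2)] 2 3 curvature_skew[OF s(2) s'(1) s(3)] curvature_skew[OF s'(2,1) s(3)] by simp
qed

lemma tensor_at_curvature:
  assumes s: "s1 \<in> Gam" "s2 \<in> Gam" "t \<in> Gam"
  shows "tensor_at Gam Gam (curvature br nab) p (s1 p) (s2 p) (t p) = curvature br nab s1 s2 t p"
  unfolding tensor_at_def
proof (rule the_equality)
  show "\<exists>x\<in>Gam. \<exists>y\<in>Gam. \<exists>z\<in>Gam. x p = s1 p \<and> y p = s2 p \<and> z p = t p \<and>
      curvature br nab s1 s2 t p = curvature br nab x y z p"
    using s by blast
qed (use s curvature_tensorial in blast)

text \<open>The metric is differentiated twice by means of its compatibility with the connection, and the
  commutator of the two derivatives is the derivative along the bracket.\<close>

lemma curvature_metric_skew: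
  assumes g: "riemannian_metric g" and comp: "metric_compatible g nab"
    and s: "s1 \<in> Gam" "s2 \<in> Gam" and t: "x \<in> Gam" "y \<in> Gam"
  shows "g p (curvature br nab s1 s2 x p) (y p) + g p (x p) (curvature br nab s1 s2 y p) = 0"
proof -
  note smooth_g = metric_smooth[OF g]
  have c: "\<rho> p (s p) (\<lambda>q. g q (t q) (t' q)) = g p (nab s t p) (t' p) + g p (t p) (nab s t' p)"
    if "s \<in> Gam" "t \<in> Gam" "t' \<in> Gam" for s t t' p
    using comp that unfolding metric_compatible_def by blast
  have cc: "\<rho> p (s p) (\<lambda>q. \<rho> q (s' q) (\<lambda>q. g q (x q) (y q))) =
      g p (nab s (nab s' x) p) (y p) + g p (nab s' x p) (nab s y p) +
      (g p (nab s x p) (nab s' y p) + g p (x p) (nab s (nab s' y) p))"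
    if "s \<in> Gam" "s' \<in> Gam" for s s'
  proof -
    have 1: "(\<lambda>q. \<rho> q (s' q) (\<lambda>q. g q (x q) (y q))) =
        (\<lambda>q. g q (nab s' x q) (y q) + g q (x q) (nab s' y q))"
      using c[OF that(2) t] by simp
    have 2: "\<rho> p (s p) (\<lambda>q. g q (nab s' x q) (y q) + g q (x q) (nab s' y q)) =
        \<rho> p (s p) (\<lambda>q. g q (nab s' x q) (y q)) + \<rho> p (s p) (\<lambda>q. g q (x q) (nab s' y q))"
      by (intro anchor_deriv_add smooth_g nab_Gam that t)
    show ?thesis
      unfolding 1 2 c[OF that(1) nab_Gam[OF that(2) t(1)] t(2)]
        c[OF that(1) t(1) nab_Gam[OF that(2) t(2)]] ..
  qed
  have "\<rho> p (br s1 s2 p) (\<lambda>q. g q (x q) (y q)) =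
      g p (nab s1 (nab s2 x) p) (y p) + g p (x p) (nab s1 (nab s2 y) p) -
      (g p (nab s2 (nab s1 x) p) (y p) + g p (x p) (nab s2 (nab s1 y) p))"
    unfolding anchor_bracket[OF s smooth_g[OF t]] cc[OF s] cc[OF s(2,1)] by simp
  then have eq: "g p (nab (br s1 s2) x p) (y p) + g p (x p) (nab (br s1 s2) y p) =
      g p (nab s1 (nab s2 x) p) (y p) + g p (x p) (nab s1 (nab s2 y) p) -
      (g p (nab s2 (nab s1 x) p) (y p) + g p (x p) (nab s2 (nab s1 y) p))"
    using c[OF bracket_closed[OF s] t] by simp
  show ?thesis
    unfolding curvature_def
    using eq
    by (simp add: metric_diff[OF g] subspace_diff[OF fibre_subspace] Gam_fib nab_Gam bracket_closed s t)
qed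

end

end

section \<open>The curvature of an almost complex connection\<close>

context almost_complex_lie_algebroid
begin

lemma J_fib: "u \<in> fib p \<Longrightarrow> J p u \<in> fib p"
  using J_endomorphism by (auto simp: bundle_endomorphism_def)

lemma J_linear:
  "u \<in> fib p \<Longrightarrow> v \<in> fib p \<Longrightarrow> J p (a *\<^sub>R u + b *\<^sub>R v) = a *\<^sub>R J p u + b *\<^sub>R J p v"
  using J_endomorphism unfolding bundle_endomorphism_def by blast

lemma J_Gam: "s \<in> Gam \<Longrightarrow> (\<lambda>p. J p (s p)) \<in> Gam"
  using J_endomorphism open_UNIV unfolding bundle_endomorphism_def by blast

lemma J_diff: "u \<in> fib p \<Longrightarrow> v \<in> fib p \<Longrightarrow> J p (u - v) = J p u - J p v"
  using J_linear[of u p v 1 "- 1"] by simp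

lemma J_sum:
  "finite I \<Longrightarrow> (\<And>i. i \<in> I \<Longrightarrow> u i \<in> fib p) \<Longrightarrow>
    J p (\<Sum>i\<in>I. c i *\<^sub>R u i) = (\<Sum>i\<in>I. c i *\<^sub>R J p (u i))"
proof (induction I rule: finite_induct)
  case empty
  have "0 \<in> fib p"
    by (rule subspace_0[OF fibre_subspace])
  from J_linear[OF this this, of 0 0] show ?case
    by simp
next
  case (insert i I)
  have "(\<Sum>i\<in>I. c i *\<^sub>R u i) \<in> fib p"
    using insert.prems by (intro subspace_sum subspace_scale fibre_subspace) auto
  then show ?case
    using J_linear[of "u i" p "\<Sum>i\<in>I. c i *\<^sub>R u i" "c i" 1] insert by simp
qed

context
  fixes nab
  assumes ac: "almost_complex_connection nab"
begin

lemma lin_conn: "linear_connection nab"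
  using ac by (simp add: almost_complex_connection_def)

lemma nab_J: "s \<in> Gam \<Longrightarrow> t \<in> Gam \<Longrightarrow> nab s (\<lambda>p. J p (t p)) = (\<lambda>p. J p (nab s t p))"
  using ac by (simp add: almost_complex_connection_def)

lemma curvature_J:
  assumes "s1 \<in> Gam" "s2 \<in> Gam" "t \<in> Gam"
  shows "curvature br nab s1 s2 (\<lambda>q. J q (t q)) p = J p (curvature br nab s1 s2 t p)"
  using assms
  by (simp add: curvature_def nab_J nab_Gam[OF lin_conn] bracket_closed J_diff Gam_fib
      subspace_diff[OF fibre_subspace])

lemma curv_eq:
  "s1 \<in> Gam \<Longrightarrow> s2 \<in> Gam \<Longrightarrow> t \<in> Gam \<Longrightarrow>
    curv nab p (s1 p) (s2 p) (t p) = curvature br nab s1 s2 t p"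
  unfolding curv_def by (rule tensor_at_curvature[OF lin_conn])

lemma curvC_eq:
  assumes u: "u \<in> fib p" "v \<in> fib p" and w: "x \<in> fib p" "y \<in> fib p"
  shows "curvC nab p u v (x, y) = (curv nab p u v x, curv nab p u v y)"
proof -
  have c: "curvature br (complexify_connection nab) s1 s2 t p =
      (curv nab p (s1 p) (s2 p) (fst (t p)), curv nab p (s1 p) (s2 p) (snd (t p)))"
    if "s1 \<in> Gam" "s2 \<in> Gam" "t \<in> GamC" for s1 s2 t
    using curv_eq[of s1 s2 "\<lambda>p. fst (t p)"] curv_eq[of s1 s2 "\<lambda>p. snd (t p)"] that
    by (simp add: GamC_def curvature_def complexify_connection_def)
  obtain s1 where s1: "s1 \<in> Gam" "s1 p = u"
    using section_through[OF u(1)] by blast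
  obtain s2 where s2: "s2 \<in> Gam" "s2 p = v"
    using section_through[OF u(2)] by blast
  obtain t1 where t1: "t1 \<in> Gam" "t1 p = x"
    using section_through[OF w(1)] by blast
  obtain t2 where t2: "t2 \<in> Gam" "t2 p = y"
    using section_through[OF w(2)] by blast
  note s = s1(1) s2(1) s1(2) s2(2)
  note t = t1(1) t2(1) t1(2) t2(2)
  have t': "(\<lambda>q. (t1 q, t2 q)) \<in> GamC"
    using t by (simp add: GamC_def)
  show ?thesis
    unfolding curvC_def tensor_at_def
  proof (rule the_equality)
    show "\<exists>s1\<in>Gam. \<exists>s2\<in>Gam. \<exists>s3\<in>GamC. s1 p = u \<and> s2 p = v \<and> s3 p = (x, y) \<and>
      (curv nab p u v x, curv nab p u v y) =
        curvature br (complexify_connection nab) s1 s2 s3 p"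
      using c[OF s(1,2) t'] s t t' by (intro bexI[of _ s1] bexI[of _ s2] bexI[OF _ t']) auto
  qed (auto simp: c)
qed

lemma curv_fib:
  assumes "u \<in> fib p" "v \<in> fib p" "x \<in> fib p"
  shows "curv nab p u v x \<in> fib p"
proof -
  obtain s1 where s1: "s1 \<in> Gam" "s1 p = u"
    using section_through[OF assms(1)] by blast
  obtain s2 where s2: "s2 \<in> Gam" "s2 p = v"
    using section_through[OF assms(2)] by blast
  obtain t where t: "t \<in> Gam" "t p = x"
    using section_through[OF assms(3)] by blast
  note s = s1(1) s2(1) t(1) s1(2) s2(2) t(2)
  show ?thesis
    using curv_eq[OF s(1-3), of p] Gam_fib[OF curvature_Gam[OF lin_conn s(1-3)], of p] s by simp
qed

lemma curv_linear:
  assumes "u \<in> fib p" "v \<in> fib p" "x \<in> fib p" "y \<in> fib p"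
  shows "curv nab p u v (a *\<^sub>R x + b *\<^sub>R y) = a *\<^sub>R curv nab p u v x + b *\<^sub>R curv nab p u v y"
proof -
  obtain s1 where s1: "s1 \<in> Gam" "s1 p = u"
    using section_through[OF assms(1)] by blast
  obtain s2 where s2: "s2 \<in> Gam" "s2 p = v"
    using section_through[OF assms(2)] by blast
  obtain t where t: "t \<in> Gam" "t p = x"
    using section_through[OF assms(3)] by blast
  obtain t' where t': "t' \<in> Gam" "t' p = y"
    using section_through[OF assms(4)] by blast
  note s = s1(1) s2(1) t(1) t'(1)
  note eq = s1(2) s2(2) t(2) t'(2)
  have "(\<lambda>q. a *\<^sub>R t q) \<in> Gam" "(\<lambda>q. b *\<^sub>R t' q) \<in> Gam"
    using s by (auto intro: Gam_scale_const)
  moreover from this have "(\<lambda>q. a *\<^sub>R t q + b *\<^sub>R t' q) \<in> Gam"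
    by (rule Gam_add)
  ultimately show ?thesis
    using curv_eq[OF s(1,2), of "\<lambda>q. a *\<^sub>R t q + b *\<^sub>R t' q" p] s
      curv_eq[OF s(1-3), of p] curv_eq[OF s(1,2,4), of p]
    by (simp add: eq curvature_add_right[OF lin_conn]
        curvature_scale_right[OF lin_conn smooth_on_const[OF open_UNIV]])
qed

lemma curv_J:
  assumes "u \<in> fib p" "v \<in> fib p" "x \<in> fib p"
  shows "curv nab p u v (J p x) = J p (curv nab p u v x)"
proof -
  obtain s1 where s1: "s1 \<in> Gam" "s1 p = u"
    using section_through[OF assms(1)] by blast
  obtain s2 where s2: "s2 \<in> Gam" "s2 p = v"
    using section_through[OF assms(2)] by blast
  obtain t where t: "t \<in> Gam" "t p = x"
    using section_through[OF assms(3)] by blast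
  note s = s1(1) s2(1) t(1) s1(2) s2(2) t(2)
  show ?thesis
    using curv_eq[OF s(1,2) J_Gam[OF s(3)], of p] curv_eq[OF s(1-3), of p] s
    by (simp add: curvature_J)
qed

lemma curv_metric_skew:
  assumes "riemannian_metric g" "metric_compatible g nab"
    and "u \<in> fib p" "v \<in> fib p" "x \<in> fib p" "y \<in> fib p"
  shows "g p (curv nab p u v x) y + g p x (curv nab p u v y) = 0"
proof -
  obtain s1 where s1: "s1 \<in> Gam" "s1 p = u"
    using section_through[OF assms(3)] by blast
  obtain s2 where s2: "s2 \<in> Gam" "s2 p = v"
    using section_through[OF assms(4)] by blast
  obtain t where t: "t \<in> Gam" "t p = x"
    using section_through[OF assms(5)] by blast
  obtain t' where t': "t' \<in> Gam" "t' p = y"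
    using section_through[OF assms(6)] by blast
  note s = s1(1) s2(1) t(1) t'(1)
  note eq = s1(2) s2(2) t(2) t'(2)
  show ?thesis
    using curvature_metric_skew[OF lin_conn assms(1,2) s, of p]
      curv_eq[OF s(1-3), of p] curv_eq[OF s(1,2,4), of p] by (simp add: eq)
qed

end

end

section \<open>Matrices as functions\<close>

text \<open>Square matrices of size \<open>N\<close> are functions of the row and column index; only the entries with
  both indices below \<open>N\<close> matter.\<close>

definition mmult :: "nat \<Rightarrow> (nat \<Rightarrow> nat \<Rightarrow> 'k::comm_ring_1) \<Rightarrow> (nat \<Rightarrow> nat \<Rightarrow> 'k) \<Rightarrow> nat \<Rightarrow> nat \<Rightarrow> 'k"
  where "mmult N X Y b a = (\<Sum>c<N. X b c * Y c a)"

definition mtrace :: "nat \<Rightarrow> (nat \<Rightarrow> nat \<Rightarrow> 'k::comm_ring_1) \<Rightarrow> 'k"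
  where "mtrace N X = (\<Sum>a<N. X a a)"

text \<open>The product \<open>M 0 \<cdots> M (k - 1)\<close>.\<close>

primrec mprod :: "nat \<Rightarrow> (nat \<Rightarrow> nat \<Rightarrow> nat \<Rightarrow> 'k::comm_ring_1) \<Rightarrow> nat \<Rightarrow> nat \<Rightarrow> nat \<Rightarrow> 'k"
  where
    "mprod N M 0 = (\<lambda>b a. if b = a then 1 else 0)"
  | "mprod N M (Suc k) = mmult N (mprod N M k) (M k)"

lemma mmult_cong:
  "(\<And>c. c < N \<Longrightarrow> X b c = X' b c) \<Longrightarrow> (\<And>c. c < N \<Longrightarrow> Y c a = Y' c a) \<Longrightarrow>
    mmult N X Y b a = mmult N X' Y' b a"
  by (simp add: mmult_def)

lemma mmult_assoc: "mmult N (mmult N X Y) Z = mmult N X (mmult N Y Z)"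
proof (intro ext)
  fix b a
  have "mmult N (mmult N X Y) Z b a = (\<Sum>c<N. \<Sum>d<N. X b d * Y d c * Z c a)"
    by (simp add: mmult_def sum_distrib_right)
  also have "\<dots> = (\<Sum>d<N. \<Sum>c<N. X b d * Y d c * Z c a)"
    by (rule sum.swap)
  also have "\<dots> = mmult N X (mmult N Y Z) b a"
    by (simp add: mmult_def sum_distrib_left mult.assoc)
  finally show "mmult N (mmult N X Y) Z b a = mmult N X (mmult N Y Z) b a" .
qed

lemma mtrace_mmult_commute: "mtrace N (mmult N X Y) = mtrace N (mmult N Y X)"
  unfolding mtrace_def mmult_def by (subst sum.swap) (simp add: mult.commute)

lemma mprod_cong: "(\<And>j. j < k \<Longrightarrow> M j = M' j) \<Longrightarrow> mprod N M k = mprod N M' k"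
  by (induction k) auto

lemma mprod_entry_cong:
  "b < N \<Longrightarrow> a < N \<Longrightarrow>
    (\<And>j b a. j < k \<Longrightarrow> b < N \<Longrightarrow> a < N \<Longrightarrow> M j b a = M' j b a) \<Longrightarrow>
    mprod N M k b a = mprod N M' k b a"
proof (induction k arbitrary: a)
  case (Suc k)
  show ?case
    unfolding mprod.simps by (rule mmult_cong) (use Suc in auto)
qed simp

lemma mprod_Suc_left:
  "b < N \<Longrightarrow> a < N \<Longrightarrow> mprod N M (Suc k) b a = mmult N (M 0) (mprod N (\<lambda>j. M (Suc j)) k) b a"
proof (induction k arbitrary: a)
  case 0
  then show ?case
    by (simp add: mmult_def if_distrib[of "\<lambda>x. x * _"] if_distrib[of "\<lambda>x. _ * x"] cong: if_cong)
next
  case (Suc k)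
  have "mprod N M (Suc (Suc k)) b a =
      mmult N (mmult N (M 0) (mprod N (\<lambda>j. M (Suc j)) k)) (M (Suc k)) b a"
    unfolding mprod.simps(2)[of N M "Suc k"] by (rule mmult_cong) (use Suc in auto)
  then show ?case
    by (simp add: mmult_assoc)
qed

section \<open>Transposition with respect to an inner product\<close>

text \<open>Bordering: the last unknown is eliminated by means of the Schur complement, which is a value
  of the quadratic form.\<close>

lemma positive_definite_solve:
  fixes G :: "nat \<Rightarrow> nat \<Rightarrow> real"
  assumes "\<And>x. \<exists>i<N. x i \<noteq> 0 \<Longrightarrow> (\<Sum>i<N. x i * (\<Sum>j<N. G i j * x j)) > 0"
  shows "\<exists>x. \<forall>j<N. (\<Sum>c<N. G j c * x c) = b j"
  using assms
proof (induction N arbitrary: b)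
  case (Suc N)
  have pos: "(\<Sum>i<N. x i * (\<Sum>j<N. G i j * x j)) > 0" if "\<exists>i<N. x i \<noteq> 0" for x
  proof -
    have "\<exists>i<Suc N. (x(N := 0)) i \<noteq> 0"
      using that by (metis fun_upd_apply less_Suc_eq less_irrefl)
    from Suc.prems[OF this] show ?thesis
      by simp
  qed
  obtain y where y: "\<And>j. j < N \<Longrightarrow> (\<Sum>c<N. G j c * y c) = b j"
    using Suc.IH[OF pos, of b] by blast
  obtain z where z: "\<And>j. j < N \<Longrightarrow> (\<Sum>c<N. G j c * z c) = G j N"
    using Suc.IH[OF pos, of "\<lambda>j. G j N"] by blast
  define d where "d = G N N - (\<Sum>c<N. G N c * z c)"
  define w where "w i = (if i < N then - z i else 1)" for i
  have w: "(\<Sum>j<Suc N. G i j * w j) = G i N - (\<Sum>j<N. G i j * z j)" for i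
    by (simp add: w_def sum_negf)
  have "(\<Sum>i<Suc N. w i * (\<Sum>j<Suc N. G i j * w j)) = d"
    unfolding w by (simp add: z d_def w_def)
  moreover have "\<exists>i<Suc N. w i \<noteq> 0"
    by (auto simp: w_def intro!: exI[of _ N])
  ultimately have d: "d > 0"
    using Suc.prems[of w] by metis
  define t where "t = (b N - (\<Sum>c<N. G N c * y c)) / d"
  define x where "x i = (if i < N then y i - t * z i else t)" for i
  have x: "(\<Sum>c<Suc N. G j c * x c) =
      (\<Sum>c<N. G j c * y c) + t * (G j N - (\<Sum>c<N. G j c * z c))" for j
    by (simp add: x_def algebra_simps sum_subtractf sum_distrib_left)
  have "(\<Sum>c<Suc N. G j c * x c) = b j" if "j < Suc N" for j
  proof (cases "j < N")
    case True
    then show ?thesis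
      unfolding x by (simp add: y z)
  next
    case False
    then have "j = N"
      using that by simp
    then show ?thesis
      unfolding x using d by (simp add: t_def flip: d_def)
  qed
  then show ?case
    by blast
qed simp

text \<open>If \<open>- B\<close> is the adjoint of \<open>A\<close> with respect to \<open>G\<close>, then \<open>A\<close> and \<open>- B\<close> have the same trace.\<close>

lemma mtrace_adjoint:
  fixes G :: "nat \<Rightarrow> nat \<Rightarrow> real"
  assumes sym: "\<And>i j. i < N \<Longrightarrow> j < N \<Longrightarrow> G i j = G j i"
    and pos: "\<And>x. \<exists>i<N. x i \<noteq> 0 \<Longrightarrow> (\<Sum>i<N. x i * (\<Sum>j<N. G i j * x j)) > 0"
    and adj: "\<And>i j. i < N \<Longrightarrow> j < N \<Longrightarrow> (\<Sum>c<N. A c i * G c j) = - (\<Sum>c<N. G i c * B c j)"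
  shows "mtrace N A = - mtrace N B"
proof -
  have "\<forall>i. \<exists>x. \<forall>j<N. (\<Sum>c<N. G j c * x c) = (if j = i then 1 else 0)"
    by (intro allI positive_definite_solve pos)
  from choice[OF this] obtain h
    where h: "\<And>i j. j < N \<Longrightarrow> (\<Sum>c<N. G j c * h i c) = (if j = i then 1 else 0)"
    by blast
  have hsym: "h i j = h j i" if "i < N" "j < N" for i j
  proof -
    have "h j i = (\<Sum>c<N. (if c = i then 1 else 0) * h j c)"
      using that by (simp add: if_distrib[of "\<lambda>x. x * _"] cong: if_cong)
    also have "\<dots> = (\<Sum>c<N. (\<Sum>a<N. G c a * h i a) * h j c)"
      by (simp add: h)
    also have "\<dots> = (\<Sum>c<N. \<Sum>a<N. h i a * (G a c * h j c))"
      by (intro sum.cong refl) (simp add: sum_distrib_right sum_distrib_left sym mult_ac)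
    also have "\<dots> = (\<Sum>a<N. h i a * (\<Sum>c<N. G a c * h j c))"
      by (subst sum.swap) (simp add: sum_distrib_left)
    also have "\<dots> = h i j"
      using that by (simp add: h if_distrib[of "\<lambda>x. _ * x"] cong: if_cong)
    finally show ?thesis ..
  qed
  have "mtrace N A = (\<Sum>a<N. \<Sum>c<N. A c a * (if c = a then 1 else 0))"
    by (simp add: mtrace_def if_distrib[of "\<lambda>x. _ * x"] cong: if_cong)
  also have "\<dots> = (\<Sum>a<N. \<Sum>c<N. A c a * (\<Sum>d<N. G c d * h a d))"
    by (intro sum.cong refl) (simp add: h)
  also have "\<dots> = (\<Sum>a<N. \<Sum>c<N. \<Sum>d<N. A c a * G c d * h a d)"
    by (simp only: sum_distrib_left mult.assoc)
  also have "\<dots> = (\<Sum>a<N. \<Sum>d<N. (\<Sum>c<N. A c a * G c d) * h a d)"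
    by (rule sum.cong[OF refl], subst sum.swap) (simp add: sum_distrib_right)
  also have "\<dots> = - (\<Sum>a<N. \<Sum>d<N. \<Sum>c<N. B c d * (G c a * h d a))"
    by (simp add: adj sum_negf sum_distrib_right)
      (intro sum.cong refl, simp add: sym hsym mult_ac)
  also have "(\<Sum>a<N. \<Sum>d<N. \<Sum>c<N. B c d * (G c a * h d a)) =
      (\<Sum>d<N. \<Sum>a<N. \<Sum>c<N. B c d * (G c a * h d a))"
    by (rule sum.swap)
  also have "\<dots> = (\<Sum>d<N. \<Sum>c<N. B c d * (\<Sum>a<N. G c a * h d a))"
    by (rule sum.cong[OF refl], subst sum.swap) (simp add: sum_distrib_left)
  also have "\<dots> = mtrace N B"
    by (simp add: h mtrace_def if_distrib[of "\<lambda>x. _ * x"] cong: if_cong)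
  finally show ?thesis .
qed

text \<open>Transposing \<open>K M\<^sub>0 \<cdots> M\<^sub>k\<^sub>-\<^sub>1\<close>, where the \<open>M\<^sub>j\<close> are self-adjoint and \<open>K\<close> is skew-adjoint, reverses
  the order of the factors and changes the sign.\<close>

lemma mtrace_reverse:
  fixes G :: "nat \<Rightarrow> nat \<Rightarrow> real"
  assumes sym: "\<And>i j. i < N \<Longrightarrow> j < N \<Longrightarrow> G i j = G j i"
    and pos: "\<And>x. \<exists>i<N. x i \<noteq> 0 \<Longrightarrow> (\<Sum>i<N. x i * (\<Sum>j<N. G i j * x j)) > 0"
    and M: "\<And>l i j. l < k \<Longrightarrow> i < N \<Longrightarrow> j < N \<Longrightarrow>
      (\<Sum>c<N. M l c i * G c j) = (\<Sum>c<N. G i c * M l c j)"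
    and K: "\<And>i j. i < N \<Longrightarrow> j < N \<Longrightarrow> (\<Sum>c<N. K c i * G c j) = - (\<Sum>c<N. G i c * K c j)"
  shows "mtrace N (mmult N K (mprod N M k)) = - mtrace N (mmult N K (mprod N (\<lambda>j. M (k - 1 - j)) k))"
proof -
  let ?T = "\<lambda>X i j. X j i"
  have adj: "mmult N (?T (mprod N M l)) G i j = mmult N G (mprod N (\<lambda>j. M (l - 1 - j)) l) i j"
    if "l \<le> k" "i < N" "j < N" for l i j
    using that
  proof (induction l arbitrary: i j)
    case 0
    then show ?case
      by (simp add: mmult_def if_distrib[of "\<lambda>x. x * _"] if_distrib[of "\<lambda>x. _ * x"] cong: if_cong)
  next
    case (Suc l)
    have "?T (mprod N M (Suc l)) = mmult N (?T (M l)) (?T (mprod N M l))"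
      by (simp add: fun_eq_iff mmult_def mult.commute)
    then have "mmult N (?T (mprod N M (Suc l))) G i j =
        mmult N (?T (M l)) (mmult N (?T (mprod N M l)) G) i j"
      by (simp only: mmult_assoc)
    also have "\<dots> = mmult N (?T (M l)) (mmult N G (mprod N (\<lambda>j. M (l - 1 - j)) l)) i j"
      by (rule mmult_cong) (use Suc in auto)
    also have "\<dots> = mmult N (mmult N (?T (M l)) G) (mprod N (\<lambda>j. M (l - 1 - j)) l) i j"
      by (simp only: mmult_assoc)
    also have "\<dots> = mmult N (mmult N G (M l)) (mprod N (\<lambda>j. M (l - 1 - j)) l) i j"
      by (rule mmult_cong) (use M[of l i] Suc.prems in \<open>auto simp: mmult_def\<close>)
    also have "\<dots> = mmult N G (mmult N (M l) (mprod N (\<lambda>j. M (l - 1 - j)) l)) i j"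
      by (simp only: mmult_assoc)
    also have "\<dots> = mmult N G (mprod N (\<lambda>j. M (Suc l - 1 - j)) (Suc l)) i j"
    proof (rule mmult_cong)
      fix c assume "c < N"
      have "(\<lambda>j. M (l - 1 - j)) = (\<lambda>j. M (Suc l - 1 - Suc j))"
        by simp
      then show "mmult N (M l) (mprod N (\<lambda>j. M (l - 1 - j)) l) c j =
          mprod N (\<lambda>j. M (Suc l - 1 - j)) (Suc l) c j"
        using mprod_Suc_left[OF \<open>c < N\<close> Suc.prems(3), of "\<lambda>j. M (Suc l - 1 - j)" l]
        by (simp only: diff_Suc_1 diff_zero)
    qed simp
    finally show ?case .
  qed
  let ?R = "mprod N (\<lambda>j. M (k - 1 - j)) k"
  have "mtrace N (mmult N K (mprod N M k)) = - mtrace N (mmult N ?R K)"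
  proof (rule mtrace_adjoint[OF sym pos])
    fix i j assume ij: "i < N" "j < N"
    have "?T (mmult N K (mprod N M k)) = mmult N (?T (mprod N M k)) (?T K)"
      by (simp add: fun_eq_iff mmult_def mult.commute)
    then have "mmult N (?T (mmult N K (mprod N M k))) G i j =
        mmult N (?T (mprod N M k)) (mmult N (?T K) G) i j"
      by (simp only: mmult_assoc)
    also have "\<dots> = mmult N (?T (mprod N M k)) (\<lambda>i j. - mmult N G K i j) i j"
      by (rule mmult_cong) (use K ij in \<open>auto simp: mmult_def\<close>)
    also have "\<dots> = - mmult N (mmult N (?T (mprod N M k)) G) K i j"
      unfolding mmult_assoc by (simp add: mmult_def[of N "?T _"] sum_negf)
    also have "\<dots> = - mmult N (mmult N G ?R) K i j"
      by (rule arg_cong[where f = uminus], rule mmult_cong) (use adj[of k i] ij in auto)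
    finally show "(\<Sum>c<N. mmult N K (mprod N M k) c i * G c j) =
        - (\<Sum>c<N. G i c * mmult N ?R K c j)"
      unfolding mmult_assoc by (simp add: mmult_def[of N _ G] mmult_def[of N G])
  qed
  then show ?thesis
    by (simp only: mtrace_mmult_commute[of N ?R K])
qed

section \<open>Block matrices and complex matrices\<close>

text \<open>The matrix with rows \<open>(X, -Y)\<close> and \<open>(Y, X)\<close>.\<close>

definition block :: "nat \<Rightarrow> (nat \<Rightarrow> nat \<Rightarrow> 'k::comm_ring_1) \<Rightarrow> (nat \<Rightarrow> nat \<Rightarrow> 'k) \<Rightarrow> nat \<Rightarrow> nat \<Rightarrow> 'k"
  where "block m X Y b a =
    (if b < m then (if a < m then X b a else - Y b (a - m))
    else (if a < m then Y (b - m) a else X (b - m) (a - m)))"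

lemma sum_lessThan_double: "(\<Sum>c<2 * m. f c) = (\<Sum>c<m. f c) + (\<Sum>c<m. f (m + c :: nat))"
  for f :: "nat \<Rightarrow> 'a::comm_monoid_add"
proof -
  have "(\<Sum>c<2 * m. f c) = (\<Sum>c\<in>{..<m} \<union> {m..<2 * m}. f c)"
    by (rule sum.cong) auto
  also have "\<dots> = (\<Sum>c<m. f c) + (\<Sum>c=m..<2 * m. f c)"
    by (rule sum.union_disjoint) auto
  also have "(\<Sum>c=m..<2 * m. f c) = (\<Sum>c<m. f (m + c))"
    using sum.shift_bounds_nat_ivl[of f 0 m m] by (simp add: mult_2 add.commute lessThan_atLeast0)
  finally show ?thesis .
qed

lemma mmult_block:
  "mmult (2 * m) (block m X Y) (block m X' Y') =
    block m (\<lambda>b a. mmult m X X' b a - mmult m Y Y' b a) (\<lambda>b a. mmult m Y X' b a + mmult m X Y' b a)"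
  unfolding fun_eq_iff mmult_def sum_lessThan_double
  by (simp add: block_def sum_negf)

lemma mtrace_block: "mtrace (2 * m) (block m X Y) = 2 * mtrace m X"
  by (simp add: mtrace_def block_def sum_lessThan_double)

text \<open>The block matrices \<open>block m X Y\<close> multiply like the complex matrices \<open>X + \<i> Y\<close>.\<close>

lemma mprod_block:
  assumes "b < 2 * m" "a < 2 * m"
  shows "mprod (2 * m) (\<lambda>j. block m (X j) (Y j)) k b a =
    block m (\<lambda>b a. Re (mprod m (\<lambda>j b a. Complex (X j b a) (Y j b a)) k b a))
      (\<lambda>b a. Im (mprod m (\<lambda>j b a. Complex (X j b a) (Y j b a)) k b a)) b a"
  using assms
proof (induction k arbitrary: a)
  case 0
  then show ?case
    by (auto simp: block_def)
next
  case (Suc k)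
  let ?P = "mprod m (\<lambda>j b a. Complex (X j b a) (Y j b a)) k"
  have "mprod (2 * m) (\<lambda>j. block m (X j) (Y j)) (Suc k) b a =
      mmult (2 * m) (block m (\<lambda>b a. Re (?P b a)) (\<lambda>b a. Im (?P b a))) (block m (X k) (Y k)) b a"
    unfolding mprod.simps(2)[of "2 * m" _ k]
    by (rule mmult_cong) (use Suc in auto)
  also have "\<dots> = block m (\<lambda>b a. Re (mprod m (\<lambda>j b a. Complex (X j b a) (Y j b a)) (Suc k) b a))
      (\<lambda>b a. Im (mprod m (\<lambda>j b a. Complex (X j b a) (Y j b a)) (Suc k) b a)) b a"
    unfolding mmult_block
    by (simp add: block_def mmult_def sum_subtractf sum.distrib add.commute)
  finally show ?case .
qed

lemma mtrace_mprod_block: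
  "mtrace (2 * m) (mprod (2 * m) (\<lambda>j. block m (X j) (Y j)) k) =
    2 * Re (mtrace m (mprod m (\<lambda>j b a. Complex (X j b a) (Y j b a)) k))"
proof -
  have "mtrace (2 * m) (mprod (2 * m) (\<lambda>j. block m (X j) (Y j)) k) =
      mtrace (2 * m) (block m
        (\<lambda>b a. Re (mprod m (\<lambda>j b a. Complex (X j b a) (Y j b a)) k b a))
        (\<lambda>b a. Im (mprod m (\<lambda>j b a. Complex (X j b a) (Y j b a)) k b a)))"
    unfolding mtrace_def by (intro sum.cong refl mprod_block) auto
  then show ?thesis
    unfolding mtrace_block by (simp add: mtrace_def)
qed

text \<open>The real form of the scalar matrix \<open>\<i>\<close>, that is, the matrix of the almost complex structure in
  a frame \<open>e\<^sub>a, J e\<^sub>a\<close>.\<close>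

definition J_matrix :: "nat \<Rightarrow> nat \<Rightarrow> nat \<Rightarrow> real"
  where "J_matrix m = block m (\<lambda>b a. 0) (\<lambda>b a. if b = a then 1 else 0)"

lemma mtrace_J_matrix_mprod_block:
  "mtrace (2 * m) (mmult (2 * m) (J_matrix m) (mprod (2 * m) (\<lambda>j. block m (X j) (Y j)) k)) =
    - 2 * Im (mtrace m (mprod m (\<lambda>j b a. Complex (X j b a) (Y j b a)) k))"
proof -
  let ?P = "mprod m (\<lambda>j b a. Complex (X j b a) (Y j b a)) k"
  have "mtrace (2 * m) (mmult (2 * m) (J_matrix m) (mprod (2 * m) (\<lambda>j. block m (X j) (Y j)) k)) =
      mtrace (2 * m) (mmult (2 * m) (J_matrix m) (block m (\<lambda>b a. Re (?P b a)) (\<lambda>b a. Im (?P b a))))"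
    unfolding mtrace_def 
    by (intro sum.cong refl, rule mmult_cong) (auto intro: mprod_block)
  also have "\<dots> = 2 * mtrace m (\<lambda>b a. - mmult m (\<lambda>b a. if b = a then 1 else 0) (\<lambda>b a. Im (?P b a)) b a)"
    unfolding J_matrix_def mmult_block mtrace_block by (simp add: mmult_def)
  also have "\<dots> = - 2 * Im (mtrace m ?P)"
    by (simp add: mtrace_def mmult_def sum_negf if_distrib[of "\<lambda>x. x * _"] cong: if_cong)
  finally show ?thesis .
qed

section \<open>Exterior powers of matrices of 2-forms\<close>

text \<open>The nested sums over permutations that arise from the iterated exterior product collapse: each
  permutation \<open>\<tau>\<close> of the first \<open>2 k\<close> indices can be absorbed into the permutation \<open>\<sigma>\<close> of all
  \<open>2 k + 2\<close> indices, which yields \<open>(2 k)!\<close> equal sums. This does not require the entries to be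
  alternating.\<close>

lemma form_matrix_power_eq:
  fixes Y :: "nat \<Rightarrow> nat \<Rightarrow> 'v \<Rightarrow> 'v \<Rightarrow> 'k::field_char_0"
  assumes X: "\<And>b a v. X b a p v = Y b a (v 0) (v 1)"
  shows "form_matrix_power N X k b a p v =
    (\<Sum>\<sigma> | \<sigma> permutes {..<2 * k}. of_int (sign \<sigma>) *
      mprod N (\<lambda>j b a. Y b a (v (\<sigma> (2 * j))) (v (\<sigma> (2 * j + 1)))) k b a) / 2 ^ k"
proof (induction k arbitrary: b a v)
  case 0
  have "{\<sigma>. \<sigma> permutes ({} :: nat set)} = {id}"
    by (auto simp: permutes_empty)
  then show ?case
    by (simp add: sign_id)
next
  case (Suc k)
  define M where "M \<sigma> = (\<lambda>j b a. Y b a (v (\<sigma> (2 * j))) (v (\<sigma> (2 * j + 1))))" for \<sigma> :: "nat \<Rightarrow> nat"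
  define F where "F \<sigma> = of_int (sign \<sigma>) * mprod N (M \<sigma>) (Suc k) b a" for \<sigma> :: "nat \<Rightarrow> nat"
  let ?S = "{\<sigma>. \<sigma> permutes {..<2 * k + 2}}" and ?T = "{\<tau>. \<tau> permutes {..<2 * k}}"
  have compose: "of_int (sign \<sigma>) * (of_int (sign \<tau>) *
      (\<Sum>c<N. mprod N (\<lambda>j b a. Y b a (v (\<sigma> (\<tau> (2 * j)))) (v (\<sigma> (\<tau> (2 * j + 1))))) k b c *
        X c a p (\<lambda>i. v (\<sigma> (2 * k + i))))) = F (\<sigma> \<circ> \<tau>)"
    if \<sigma>: "\<sigma> \<in> ?S" and \<tau>: "\<tau> \<in> ?T" for \<sigma> \<tau>
  proof -
    have "\<tau> (2 * k) = 2 * k" "\<tau> (Suc (2 * k)) = Suc (2 * k)"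
      using \<tau> permutes_not_in by fastforce+
    then have "mprod N (M (\<sigma> \<circ> \<tau>)) (Suc k) b a =
        (\<Sum>c<N. mprod N (M (\<sigma> \<circ> \<tau>)) k b c * X c a p (\<lambda>i. v (\<sigma> (2 * k + i))))"
      by (simp add: mmult_def M_def X)
    moreover have "sign (\<sigma> \<circ> \<tau>) = sign \<sigma> * sign \<tau>"
      using \<sigma> \<tau> by (intro sign_compose permutes_imp_permutation[of "{..<_}"]) auto
    ultimately show ?thesis
      by (simp add: F_def M_def mult.assoc)
  qed
  have reindex: "(\<Sum>\<sigma>\<in>?S. F (\<sigma> \<circ> \<tau>)) = (\<Sum>\<sigma>\<in>?S. F \<sigma>)" if "\<tau> \<in> ?T" for \<tau>
    by (rule sum_permutations_compose_right[symmetric])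
      (use that permutes_subset[of \<tau> "{..<2 * k}"] in auto)
  have card: "card ?T = fact (2 * k)"
    by (rule card_permutations) auto
  have "form_matrix_power N X (Suc k) b a p v =
      (\<Sum>c<N. (\<Sum>\<sigma>\<in>?S. of_int (sign \<sigma>) * ((\<Sum>\<tau>\<in>?T. of_int (sign \<tau>) *
        mprod N (\<lambda>j b a. Y b a (v (\<sigma> (\<tau> (2 * j)))) (v (\<sigma> (\<tau> (2 * j + 1))))) k b c) / 2 ^ k) *
        X c a p (\<lambda>i. v (\<sigma> (2 * k + i)))) / (fact (2 * k) * fact 2))"
    by (simp only: form_matrix_power.simps wedge_def Suc.IH)
  also have "\<dots> = (\<Sum>c<N. \<Sum>\<sigma>\<in>?S. \<Sum>\<tau>\<in>?T. of_int (sign \<sigma>) * (of_int (sign \<tau>) *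
        (mprod N (\<lambda>j b a. Y b a (v (\<sigma> (\<tau> (2 * j)))) (v (\<sigma> (\<tau> (2 * j + 1))))) k b c *
        X c a p (\<lambda>i. v (\<sigma> (2 * k + i)))))) / (2 ^ k * (fact (2 * k) * fact 2))"
    by (simp only: sum_distrib_left sum_distrib_right sum_divide_distrib times_divide_eq_left
        times_divide_eq_right divide_divide_eq_left mult.assoc)
  also have "(\<Sum>c<N. \<Sum>\<sigma>\<in>?S. \<Sum>\<tau>\<in>?T. of_int (sign \<sigma>) * (of_int (sign \<tau>) *
        (mprod N (\<lambda>j b a. Y b a (v (\<sigma> (\<tau> (2 * j)))) (v (\<sigma> (\<tau> (2 * j + 1))))) k b c *
        X c a p (\<lambda>i. v (\<sigma> (2 * k + i)))))) =
      (\<Sum>\<sigma>\<in>?S. \<Sum>\<tau>\<in>?T. \<Sum>c<N. of_int (sign \<sigma>) * (of_int (sign \<tau>) *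
        (mprod N (\<lambda>j b a. Y b a (v (\<sigma> (\<tau> (2 * j)))) (v (\<sigma> (\<tau> (2 * j + 1))))) k b c *
        X c a p (\<lambda>i. v (\<sigma> (2 * k + i))))))"
    by (subst sum.swap, rule sum.cong[OF refl], rule sum.swap)
  also have "\<dots> = (\<Sum>\<sigma>\<in>?S. \<Sum>\<tau>\<in>?T. F (\<sigma> \<circ> \<tau>))"
    by (intro sum.cong refl) (simp only: sum_distrib_left[symmetric] compose)
  also have "\<dots> = (\<Sum>\<tau>\<in>?T. \<Sum>\<sigma>\<in>?S. F \<sigma>)"
    by (subst sum.swap, intro sum.cong refl reindex)
  also have "\<dots> = fact (2 * k) * (\<Sum>\<sigma>\<in>?S. F \<sigma>)"
    by (simp add: card)
  also have "fact (2 * k) * (\<Sum>\<sigma>\<in>?S. F \<sigma>) / (2 ^ k * (fact (2 * k) * fact 2)) =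
      (\<Sum>\<sigma>\<in>?S. F \<sigma>) / 2 ^ Suc k"
    by (simp add: fact_2)
  finally show ?case
    by (simp add: F_def M_def)
qed

lemma form_trace_power_eq:
  fixes Y :: "nat \<Rightarrow> nat \<Rightarrow> 'v \<Rightarrow> 'v \<Rightarrow> 'k::field_char_0"
  assumes "\<And>b a v. X b a p v = Y b a (v 0) (v 1)"
  shows "form_trace N (form_matrix_power N X k) p v =
    (\<Sum>\<sigma> | \<sigma> permutes {..<2 * k}. of_int (sign \<sigma>) *
      mtrace N (mprod N (\<lambda>j b a. Y b a (v (\<sigma> (2 * j))) (v (\<sigma> (2 * j + 1)))) k)) / 2 ^ k"
proof -
  have "form_trace N (form_matrix_power N X k) p v =
    (\<Sum>a<N. \<Sum>\<sigma> | \<sigma> permutes {..<2 * k}. of_int (sign \<sigma>) *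
      mprod N (\<lambda>j b a. Y b a (v (\<sigma> (2 * j))) (v (\<sigma> (2 * j + 1)))) k a a) / 2 ^ k"
    unfolding form_trace_def form_matrix_power_eq[where X = X and Y = Y, OF assms]
    by (simp only: sum_divide_distrib)
  then show ?thesis
    unfolding mtrace_def sum_distrib_left by (subst (asm) sum.swap)
qed

text \<open>The permutation of the indices that reverses the order of \<open>k\<close> consecutive pairs. It is even
  because it acts in the same way on the even and on the odd numbers, which are exchanged by an
  involution \<open>s\<close>.\<close>

definition reverse_pairs :: "nat \<Rightarrow> nat \<Rightarrow> nat"
  where "reverse_pairs k i = (if i < 2 * k then 2 * (k - 1 - i div 2) + i mod 2 else i)"

lemma involution_permutes:
  assumes "\<And>x. f (f x) = x" "\<And>x. x \<notin> S \<Longrightarrow> f x = x"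
  shows "f permutes S"
  unfolding permutes_def using assms by metis

lemma reverse_pairs_permutes: "reverse_pairs k permutes {..<2 * k}"
proof (rule involution_permutes)
  show "reverse_pairs k (reverse_pairs k x) = x" for x
  proof (cases "x < 2 * k")
    case True
    then have "x div 2 < k"
      by auto
    then have "2 * (k - 1 - x div 2) + x mod 2 < 2 * k" "k - 1 - (k - 1 - x div 2) = x div 2"
      by auto
    then show ?thesis
      using True by (simp add: reverse_pairs_def)
  qed (simp add: reverse_pairs_def)
qed (simp add: reverse_pairs_def)

lemma sign_reverse_pairs: "sign (reverse_pairs k) = 1"
proof -
  \<comment> \<open>The reversal on the even numbers.\<close>
  define \<alpha> where "\<alpha> i = (if i < 2 * k \<and> even i then 2 * k - 2 - i else i)" for i :: nat
  define s where "s i = (if i < 2 * k then if even i then i + 1 else i - 1 else i)" for i :: nat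
  have \<alpha>: "\<alpha> permutes {..<2 * k}"
    by (rule involution_permutes) (auto simp: \<alpha>_def)
  have s: "s permutes {..<2 * k}"
  proof (rule involution_permutes)
    have "i + 1 < 2 * k" if "i < 2 * k" "even i" for i
      using that by presburger
    then show "s (s i) = i" for i
      by (auto simp: s_def)
  qed (auto simp: s_def)
  have perm: "permutation \<alpha>" "permutation s"
    using \<alpha> s permutes_imp_permutation by blast+
  have eq: "reverse_pairs k = (s \<circ> \<alpha> \<circ> s) \<circ> \<alpha>"
  proof
    fix i
    show "reverse_pairs k i = ((s \<circ> \<alpha> \<circ> s) \<circ> \<alpha>) i"
    proof (cases "i < 2 * k")
      case True
      show ?thesis
      proof (cases "even i")
        case even: True
        then obtain j where j: "i = 2 * j" by blast
        then have "j < k"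
          using True by simp
        then have "\<alpha> i = 2 * (k - 1 - j)"
          by (simp add: j \<alpha>_def algebra_simps)
        moreover have "2 * (k - 1 - j) + 1 < 2 * k"
          using \<open>j < k\<close> by simp
        ultimately show ?thesis
          using \<open>j < k\<close> by (simp add: reverse_pairs_def s_def \<alpha>_def j)
      next
        case odd: False
        then obtain j where j: "i = 2 * j + 1" by (elim oddE)
        then have "j < k"
          using True by simp
        then have "\<alpha> (2 * j) = 2 * (k - 1 - j)" "s i = 2 * j" "\<alpha> i = i"
          by (simp_all add: j \<alpha>_def s_def algebra_simps)
        moreover have "s (2 * (k - 1 - j)) = 2 * (k - 1 - j) + 1"
          using \<open>j < k\<close> by (simp add: s_def)
        ultimately show ?thesis
          using \<open>j < k\<close> by (simp add: reverse_pairs_def j)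
      qed
    next
      case False
      then show ?thesis
        by (simp add: reverse_pairs_def \<alpha>_def s_def)
    qed
  qed
  have "sign (reverse_pairs k) = (sign s * sign s) * (sign \<alpha> * sign \<alpha>)"
    unfolding eq by (simp only: sign_compose permutation_compose perm mult_ac)
  then show ?thesis
    by simp
qed

text \<open>An alternating sum of expressions in \<open>k\<close> pairs of permuted indices does not change if the pairs
  are taken in the reverse order.\<close>

lemma sum_permutations_reverse_pairs:
  fixes f :: "(nat \<Rightarrow> 'b) \<Rightarrow> 'a::comm_ring_1"
  assumes cong: "\<And>h h'. (\<And>j. j < k \<Longrightarrow> h j = h' j) \<Longrightarrow> f h = f h'"
  shows "(\<Sum>\<sigma> | \<sigma> permutes {..<2 * k}. of_int (sign \<sigma>) * f (\<lambda>j. M (\<sigma> (2 * j)) (\<sigma> (2 * j + 1)))) =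
    (\<Sum>\<sigma> | \<sigma> permutes {..<2 * k}. of_int (sign \<sigma>) *
      f (\<lambda>j. M (\<sigma> (2 * (k - 1 - j))) (\<sigma> (2 * (k - 1 - j) + 1))))"
  (is "_ = sum ?g _")
proof -
  let ?r = "reverse_pairs k"
  have "(\<Sum>\<sigma> | \<sigma> permutes {..<2 * k}. of_int (sign \<sigma>) * f (\<lambda>j. M (\<sigma> (2 * j)) (\<sigma> (2 * j + 1)))) =
      (\<Sum>\<sigma> | \<sigma> permutes {..<2 * k}. of_int (sign (\<sigma> \<circ> ?r)) *
        f (\<lambda>j. M ((\<sigma> \<circ> ?r) (2 * j)) ((\<sigma> \<circ> ?r) (2 * j + 1))))"
    by (rule sum_permutations_compose_right[OF reverse_pairs_permutes])
  also have "\<dots> = sum ?g {\<sigma>. \<sigma> permutes {..<2 * k}}"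
  proof (rule sum.cong[OF refl])
    fix \<sigma> assume "\<sigma> \<in> {\<sigma>. \<sigma> permutes {..<2 * k}}"
    then have "sign (\<sigma> \<circ> ?r) = sign \<sigma>"
      using sign_compose[of \<sigma> ?r] permutes_imp_permutation[of "{..<2 * k}"] reverse_pairs_permutes
      by (simp add: sign_reverse_pairs)
    moreover have "f (\<lambda>j. M ((\<sigma> \<circ> ?r) (2 * j)) ((\<sigma> \<circ> ?r) (2 * j + 1))) =
        f (\<lambda>j. M (\<sigma> (2 * (k - 1 - j))) (\<sigma> (2 * (k - 1 - j) + 1)))"
      by (rule cong) (simp add: reverse_pairs_def)
    ultimately show "of_int (sign (\<sigma> \<circ> ?r)) *
        f (\<lambda>j. M ((\<sigma> \<circ> ?r) (2 * j)) ((\<sigma> \<circ> ?r) (2 * j + 1))) = ?g \<sigma>"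
      by simp
  qed
  finally show ?thesis .
qed

section \<open>The curvature matrices in a local frame\<close>

context almost_complex_lie_algebroid
begin

context
  fixes U e p
  assumes frame: "local_J_frame U e" and p: "p \<in> U"
begin

lemma frame_vec_inj: "inj_on (frame_vec e p) {..<2 * m}"
  and frame_vec_independent: "independent (frame_vec e p ` {..<2 * m})"
  and frame_vec_span: "span (frame_vec e p ` {..<2 * m}) = fib p"
  using frame p by (auto simp: local_J_frame_def)

lemma frame_vec_fib: "i < 2 * m \<Longrightarrow> frame_vec e p i \<in> fib p"
  unfolding frame_vec_span[symmetric] by (intro span_base imageI) simp

lemma frame_fib: "a < m \<Longrightarrow> e a p \<in> fib p"
  using frame_vec_fib[of a] by (simp add: frame_vec_def)

lemma frame_vec_independentD:
  assumes "(\<Sum>i<2 * m. c i *\<^sub>R frame_vec e p i) = 0" "i < 2 * m"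
  shows "c i = 0"
proof -
  let ?inv = "the_inv_into {..<2 * m} (frame_vec e p)"
  have "(\<Sum>x\<in>frame_vec e p ` {..<2 * m}. c (?inv x) *\<^sub>R x) = 0"
    using assms(1) by (simp add: sum.reindex frame_vec_inj the_inv_into_f_f)
  from independentD[OF frame_vec_independent finite_imageI[OF finite_lessThan] order_refl this,
      of "frame_vec e p i"]
  show ?thesis
    using assms(2) by (simp add: the_inv_into_f_f frame_vec_inj)
qed

lemma frame_vec_unique:
  assumes "(\<Sum>i<2 * m. c i *\<^sub>R frame_vec e p i) = (\<Sum>i<2 * m. d i *\<^sub>R frame_vec e p i)" "i < 2 * m"
  shows "c i = d i"
  using frame_vec_independentD[of "\<lambda>i. c i - d i" i] assms
  by (simp add: scaleR_left_diff_distrib sum_subtractf)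

lemma frame_coord_eqI:
  assumes "u = (\<Sum>i<2 * m. c i *\<^sub>R frame_vec e p i)" "\<And>i. i \<ge> 2 * m \<Longrightarrow> c i = 0"
  shows "frame_coord e p u = c"
  unfolding frame_coord_def
proof (rule the_equality)
  fix d assume d: "(\<forall>i\<ge>2 * m. d i = 0) \<and> u = (\<Sum>i<2 * m. d i *\<^sub>R frame_vec e p i)"
  show "d = c"
  proof
    fix i
    show "d i = c i"
    proof (cases "i < 2 * m")
      case True
      show ?thesis
        by (rule frame_vec_unique[OF _ True]) (use d assms(1) in simp)
    qed (use d assms(2) in simp)
  qed
qed (use assms in simp)

lemma frame_coord_sum:
  assumes u: "u \<in> fib p"
  shows "u = (\<Sum>i<2 * m. frame_coord e p u i *\<^sub>R frame_vec e p i)"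
proof -
  have "u \<in> span (frame_vec e p ` {..<2 * m})"
    using u frame_vec_span by simp
  then obtain d where "u = (\<Sum>x\<in>frame_vec e p ` {..<2 * m}. d x *\<^sub>R x)"
    by (auto simp: span_finite)
  then have "u = (\<Sum>i<2 * m. (if i < 2 * m then d (frame_vec e p i) else 0) *\<^sub>R frame_vec e p i)"
    by (simp add: sum.reindex frame_vec_inj)
  from frame_coord_eqI[OF this] this show ?thesis
    by simp
qed

lemma sum_frame_vec:
  "(\<Sum>i<2 * m. c i *\<^sub>R frame_vec e p i) = (\<Sum>b<m. c b *\<^sub>R e b p + c (m + b) *\<^sub>R J p (e b p))"
  by (simp add: sum_lessThan_double frame_vec_def sum.distrib)

lemma J_frame_sum:
  "J p (\<Sum>b<m. c b *\<^sub>R e b p + d b *\<^sub>R J p (e b p)) = (\<Sum>b<m. (- d b) *\<^sub>R e b p + c b *\<^sub>R J p (e b p))"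
proof -
  have "J p (\<Sum>b<m. c b *\<^sub>R e b p + d b *\<^sub>R J p (e b p)) =
      (\<Sum>b<m. J p (c b *\<^sub>R e b p + d b *\<^sub>R J p (e b p)))"
    using J_sum[of "{..<m}" "\<lambda>b. c b *\<^sub>R e b p + d b *\<^sub>R J p (e b p)" p "\<lambda>_. 1"]
    by (simp add: frame_fib J_fib subspace_add subspace_scale fibre_subspace)
  also have "\<dots> = (\<Sum>b<m. (- d b) *\<^sub>R e b p + c b *\<^sub>R J p (e b p))"
    by (intro sum.cong refl) (simp add: J_linear frame_fib J_fib J_squared)
  finally show ?thesis .
qed

text \<open>A section of the \<open>\<i>\<close>-eigenbundle is determined by its real part \<open>u\<close>, as \<open>u - \<i> J u\<close>, and its
  complex coordinates combine the real coordinates of \<open>u\<close>.\<close>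

lemma sum_cscale_frame10:
  "(\<Sum>b<m. cscale (c b) (frame10 e b p)) =
    ((\<Sum>b<m. Re (c b) *\<^sub>R e b p + Im (c b) *\<^sub>R J p (e b p)),
     - J p (\<Sum>b<m. Re (c b) *\<^sub>R e b p + Im (c b) *\<^sub>R J p (e b p)))"
  unfolding J_frame_sum
  by (simp add: prod_eq_iff fst_sum snd_sum cscale_def frame10_def sum_negf[symmetric])

lemma frame10_coord_eq:
  assumes u: "u \<in> fib p" and b: "b < m"
  shows "frame10_coord e p (u, - J p u) b =
    Complex (frame_coord e p u b) (frame_coord e p u (m + b))"
proof -
  define c where "c b = (if b < m then Complex (frame_coord e p u b) (frame_coord e p u (m + b)) else 0)"
    for b
  have uc: "u = (\<Sum>b<m. Re (c b) *\<^sub>R e b p + Im (c b) *\<^sub>R J p (e b p))"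
    using frame_coord_sum[OF u] unfolding sum_frame_vec by (simp add: c_def)
  have "frame10_coord e p (u, - J p u) = c"
    unfolding frame10_coord_def
  proof (rule the_equality)
    show "(\<forall>b\<ge>m. c b = 0) \<and> (u, - J p u) = (\<Sum>b<m. cscale (c b) (frame10 e b p))"
      unfolding sum_cscale_frame10 using uc by (simp add: c_def)
    fix d assume d: "(\<forall>b\<ge>m. d b = 0) \<and> (u, - J p u) = (\<Sum>b<m. cscale (d b) (frame10 e b p))"
    define d' where "d' i = (if i < m then Re (d i) else if i < 2 * m then Im (d (i - m)) else 0)" for i
    have "u = (\<Sum>b<m. Re (d b) *\<^sub>R e b p + Im (d b) *\<^sub>R J p (e b p))"
      using d unfolding sum_cscale_frame10 by simp
    then have "u = (\<Sum>i<2 * m. d' i *\<^sub>R frame_vec e p i)"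
      unfolding sum_frame_vec by (simp add: d'_def)
    then have d': "frame_coord e p u = d'"
      by (rule frame_coord_eqI) (simp add: d'_def)
    show "d = c"
      using d by (auto simp: fun_eq_iff c_def d' d'_def complex_eq_iff)
  qed
  then show ?thesis
    using b by (simp add: c_def)
qed

lemma J_frame_vec:
  assumes i: "i < 2 * m"
  shows "J p (frame_vec e p i) = (\<Sum>c<2 * m. J_matrix m c i *\<^sub>R frame_vec e p c)"
proof (cases "i < m")
  case True
  then show ?thesis
    unfolding sum_frame_vec
    by (simp add: frame_vec_def J_matrix_def block_def if_distrib[of "\<lambda>x. x *\<^sub>R _"] cong: if_cong)
next
  case False
  then have "i - m < m"
    using i by simp
  then show ?thesis
    unfolding sum_frame_vec using False
    by (simp add: frame_vec_def J_matrix_def block_def if_distrib[of "\<lambda>x. x *\<^sub>R _"]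
        if_distrib[of uminus] J_squared frame_fib cong: if_cong)
qed

context
  fixes nab
  assumes ac: "almost_complex_connection nab"
begin

text \<open>The coordinates of \<open>J R(x, y) e\<^sub>a\<close> at \<open>e\<^sub>b\<close> and at \<open>J e\<^sub>b\<close>.\<close>

abbreviation RM :: "nat \<Rightarrow> nat \<Rightarrow> 'v \<Rightarrow> 'v \<Rightarrow> real"
  where "RM \<equiv> \<lambda>b a x y. frame_coord e p (J p (curv nab p x y (e a p))) b"

abbreviation RsM :: "nat \<Rightarrow> nat \<Rightarrow> 'v \<Rightarrow> 'v \<Rightarrow> real"
  where "RsM \<equiv> \<lambda>b a x y. frame_coord e p (J p (curv nab p x y (e a p))) (m + b)"

text \<open>This is the identity \<open>\<i> \<Phi> = R + \<i> R\<^sup>*\<close>.\<close>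

lemma curvature_matrix_eq:
  assumes v: "v 0 \<in> fib p" "v 1 \<in> fib p" and ba: "b < m" "a < m"
  shows "\<i> * curvature_matrix nab e b a p v =
    Complex (RM b a (v 0) (v 1)) (RsM b a (v 0) (v 1))"
proof -
  note ea = frame_fib[OF ba(2)]
  let ?u = "curv nab p (v 0) (v 1) (e a p)"
  let ?c = "frame_coord e p ?u"
  have u: "?u \<in> fib p"
    by (rule curv_fib[OF ac v ea])
  \<comment> \<open>The form in which \<open>curv_linear\<close> applies to the negative of a vector.\<close>
  have neg: "- J p (e a p) = (- 1) *\<^sub>R J p (e a p) + 0 *\<^sub>R J p (e a p)"
    by simp
  have Je: "J p (e a p) \<in> fib p" "- J p (e a p) \<in> fib p"
    using J_fib[OF ea] subspace_neg[OF fibre_subspace] by auto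
  have "curv nab p (v 0) (v 1) (- J p (e a p)) = - J p ?u"
    unfolding neg curv_linear[OF ac v Je(1,1)] curv_J[OF ac v ea] by simp
  then have "curvC nab p (v 0) (v 1) (frame10 e a p) = (?u, - J p ?u)"
    unfolding frame10_def curvC_eq[OF ac v ea Je(2)] by (rule arg_cong)
  then have \<Phi>: "curvature_matrix nab e b a p v = Complex (?c b) (?c (m + b))"
    by (simp only: curvature_matrix_def frame10_coord_eq[OF u ba(1)])
  define d where "d i = (if i < m then - ?c (m + i) else if i < 2 * m then ?c (i - m) else 0)" for i
  have "?u = (\<Sum>b<m. ?c b *\<^sub>R e b p + ?c (m + b) *\<^sub>R J p (e b p))"
    using frame_coord_sum[OF u] unfolding sum_frame_vec .
  from arg_cong[OF this, of "J p"]
  have "J p ?u = (\<Sum>b<m. (- ?c (m + b)) *\<^sub>R e b p + ?c b *\<^sub>R J p (e b p))"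
    unfolding J_frame_sum .
  also have "\<dots> = (\<Sum>i<2 * m. d i *\<^sub>R frame_vec e p i)"
    unfolding sum_frame_vec by (simp add: d_def)
  finally have "frame_coord e p (J p ?u) = d"
    by (rule frame_coord_eqI) (simp add: d_def)
  then show ?thesis
    using ba(1) by (simp add: \<Phi> d_def complex_eq_iff)
qed

lemma JR_frame_vec:
  assumes xy: "x \<in> fib p" "y \<in> fib p" and i: "i < 2 * m"
  shows "J p (curv nab p x y (frame_vec e p i)) =
    (\<Sum>c<2 * m. block m (\<lambda>b a. RM b a x y) (\<lambda>b a. RsM b a x y) c i *\<^sub>R frame_vec e p c)"
proof -
  have e: "J p (curv nab p x y (e a p)) =
      (\<Sum>b<m. RM b a x y *\<^sub>R e b p + RsM b a x y *\<^sub>R J p (e b p))" if "a < m" for a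
    using frame_coord_sum[OF J_fib[OF curv_fib[OF ac xy frame_fib[OF that]]]]
    unfolding sum_frame_vec .
  show ?thesis
  proof (cases "i < m")
    case True
    then have "J p (curv nab p x y (frame_vec e p i)) = J p (curv nab p x y (e i p))"
      by (simp add: frame_vec_def)
    also have "\<dots> = (\<Sum>b<m. RM b i x y *\<^sub>R e b p + RsM b i x y *\<^sub>R J p (e b p))"
      by (rule e[OF True])
    finally show ?thesis
      unfolding sum_frame_vec using True by (simp add: block_def)
  next
    case False
    then have a: "i - m < m"
      using i by simp
    have "J p (curv nab p x y (frame_vec e p i)) = J p (J p (curv nab p x y (e (i - m) p)))"
      using False by (simp add: frame_vec_def curv_J[OF ac xy frame_fib[OF a]])
    also have "\<dots> = (\<Sum>b<m. (- RsM b (i - m) x y) *\<^sub>R e b p + RM b (i - m) x y *\<^sub>R J p (e b p))"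
      by (rule trans[OF arg_cong[OF e[OF a], where f = "J p"] J_frame_sum])
    finally show ?thesis
      unfolding sum_frame_vec using False by (simp add: block_def)
  qed
qed

text \<open>For a Hermitian metric, \<open>J R(x, y)\<close> is self-adjoint because \<open>R(x, y)\<close> and \<open>J\<close> are commuting
  skew-adjoint operators.\<close>

context
  fixes g
  assumes herm: "hermitian_metric g" and comp: "metric_compatible g nab"
begin

lemma riem: "riemannian_metric g"
  using herm unfolding hermitian_metric_def by (rule conjunct1)

lemma J_skew:
  assumes u: "u \<in> fib p" and w: "w \<in> fib p"
  shows "g p (J p u) w = - g p u (J p w)"
proof -
  have "\<forall>p. \<forall>u\<in>fib p. \<forall>v\<in>fib p. g p (J p u) (J p v) = g p u v"
    using herm unfolding hermitian_metric_def by (rule conjunct2)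
  then have "g p (J p (J p u)) (J p w) = g p (J p u) w"
    using J_fib[OF u] w by blast
  then show ?thesis
    unfolding J_squared[OF u] metric_minus(1)[OF riem u J_fib[OF w]] by simp
qed

lemma JR_self_adjoint:
  assumes xy: "x \<in> fib p" "y \<in> fib p" and uw: "u \<in> fib p" "w \<in> fib p"
  shows "g p (J p (curv nab p x y u)) w = g p u (J p (curv nab p x y w))"
  using J_skew[OF curv_fib[OF ac xy uw(1)] uw(2)]
    curv_metric_skew[OF ac riem comp xy uw(1) J_fib[OF uw(2)]] curv_J[OF ac xy uw(2)] by simp

text \<open>The Gram matrix of the frame.\<close>

definition gram :: "nat \<Rightarrow> nat \<Rightarrow> real"
  where "gram i j = g p (frame_vec e p i) (frame_vec e p j)"

lemma gram_sym: "i < 2 * m \<Longrightarrow> j < 2 * m \<Longrightarrow> gram i j = gram j i"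
  unfolding gram_def by (rule metric_sym[OF riem]) (auto intro: frame_vec_fib)

lemma gram_right:
  assumes "i < 2 * m"
  shows "g p (frame_vec e p i) (\<Sum>c<2 * m. a c *\<^sub>R frame_vec e p c) = (\<Sum>c<2 * m. gram i c * a c)"
  using metric_sum_right[OF riem, of "{..<2 * m}" "frame_vec e p" p "frame_vec e p i" a] assms
  by (simp add: frame_vec_fib gram_def mult.commute)

lemma gram_left:
  assumes "i < 2 * m"
  shows "g p (\<Sum>c<2 * m. a c *\<^sub>R frame_vec e p c) (frame_vec e p i) = (\<Sum>c<2 * m. a c * gram c i)"
proof -
  have "(\<Sum>c<2 * m. a c *\<^sub>R frame_vec e p c) \<in> fib p"
    by (intro subspace_sum subspace_scale fibre_subspace frame_vec_fib) auto
  then have "g p (\<Sum>c<2 * m. a c *\<^sub>R frame_vec e p c) (frame_vec e p i) =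
      (\<Sum>c<2 * m. gram i c * a c)"
    by (rule trans[OF metric_sym[OF riem _ frame_vec_fib[OF assms]] gram_right[OF assms]])
  also have "\<dots> = (\<Sum>c<2 * m. a c * gram c i)"
    by (intro sum.cong refl) (simp add: gram_sym assms)
  finally show ?thesis .
qed

lemma gram_pos:
  assumes "\<exists>i<2 * m. x i \<noteq> 0"
  shows "(\<Sum>i<2 * m. x i * (\<Sum>j<2 * m. gram i j * x j)) > 0"
proof -
  let ?u = "\<Sum>i<2 * m. x i *\<^sub>R frame_vec e p i"
  have u: "?u \<in> fib p"
    by (intro subspace_sum subspace_scale fibre_subspace frame_vec_fib) auto
  have "?u \<noteq> 0"
  proof
    assume "?u = 0"
    then have "x i = 0" if "i < 2 * m" for i
      using that by (rule frame_vec_independentD)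
    then show False
      using assms by blast
  qed
  then have "g p ?u ?u > 0"
    by (rule metric_pos[OF riem u])
  also have "g p ?u ?u = (\<Sum>i<2 * m. x i * g p ?u (frame_vec e p i))"
    by (rule metric_sum_right[OF riem]) (auto intro: u frame_vec_fib)
  also have "\<dots> = (\<Sum>i<2 * m. x i * (\<Sum>j<2 * m. gram i j * x j))"
  proof (rule sum.cong[OF refl])
    show "x i * g p ?u (frame_vec e p i) = x i * (\<Sum>j<2 * m. gram i j * x j)"
      if "i \<in> {..<2 * m}" for i
    proof -
      have i: "i < 2 * m"
        using that by simp
      show ?thesis
        by (rule arg_cong[OF trans[OF metric_sym[OF riem u frame_vec_fib[OF i]] gram_right[OF i]]])
    qed
  qed
  finally show ?thesis .
qed

text \<open>The matrix of \<open>J R(x, y)\<close> in the frame \<open>e\<^sub>a, J e\<^sub>a\<close>.\<close>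

abbreviation JR_matrix :: "'v \<Rightarrow> 'v \<Rightarrow> nat \<Rightarrow> nat \<Rightarrow> real"
  where "JR_matrix x y \<equiv> block m (\<lambda>b a. RM b a x y) (\<lambda>b a. RsM b a x y)"

lemma JR_matrix_adjoint:
  assumes xy: "x \<in> fib p" "y \<in> fib p" and ij: "i < 2 * m" "j < 2 * m"
  shows "(\<Sum>c<2 * m. JR_matrix x y c i * gram c j) = (\<Sum>c<2 * m. gram i c * JR_matrix x y c j)"
  using JR_self_adjoint[OF xy ij[THEN frame_vec_fib]]
  unfolding JR_frame_vec[OF xy ij(1)] JR_frame_vec[OF xy ij(2)] gram_left[OF ij(2)]
    gram_right[OF ij(1)] .

lemma J_matrix_adjoint:
  assumes ij: "i < 2 * m" "j < 2 * m"
  shows "(\<Sum>c<2 * m. J_matrix m c i * gram c j) = - (\<Sum>c<2 * m. gram i c * J_matrix m c j)"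
  using J_skew[OF ij[THEN frame_vec_fib]]
  unfolding J_frame_vec[OF ij(1)] J_frame_vec[OF ij(2)] gram_left[OF ij(2)] gram_right[OF ij(1)] .

context
  fixes k :: nat and v :: "nat \<Rightarrow> 'v"
  assumes v: "\<And>i. i < 2 * k \<Longrightarrow> v i \<in> fib p"
begin

lemma permuted_fib:
  assumes "\<sigma> permutes {..<2 * k}" "j < k"
  shows "v (\<sigma> (2 * j)) \<in> fib p" "v (\<sigma> (2 * j + 1)) \<in> fib p"
proof -
  have "\<sigma> i < 2 * k" if "i < 2 * k" for i
    using permutes_in_image[OF assms(1), of i] that by simp
  then show "v (\<sigma> (2 * j)) \<in> fib p" "v (\<sigma> (2 * j + 1)) \<in> fib p"
    using assms(2) by (auto intro!: v)
qed

text \<open>The trace of the product of the matrices \<open>\<i> \<Phi>\<close> at the \<open>k\<close> pairs of permuted vectors.\<close>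

definition trace_term :: "(nat \<Rightarrow> nat) \<Rightarrow> complex"
  where "trace_term \<sigma> = mtrace m (mprod m (\<lambda>j b a.
    Complex (RM b a (v (\<sigma> (2 * j))) (v (\<sigma> (2 * j + 1))))
      (RsM b a (v (\<sigma> (2 * j))) (v (\<sigma> (2 * j + 1))))) k)"

lemma sum_Im_trace_term:
  "(\<Sum>\<sigma> | \<sigma> permutes {..<2 * k}. of_int (sign \<sigma>) * Im (trace_term \<sigma>)) = 0"
proof -
  define f where "f h = mtrace (2 * m) (mmult (2 * m) (J_matrix m) (mprod (2 * m) h k))" for h
  define M where "M a b = JR_matrix (v a) (v b)" for a b
  let ?P = "{\<sigma>. \<sigma> permutes {..<2 * k}}"
  have f: "f (\<lambda>j. M (\<sigma> (2 * j)) (\<sigma> (2 * j + 1))) = - 2 * Im (trace_term \<sigma>)" for \<sigma>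
    unfolding f_def M_def trace_term_def by (rule mtrace_J_matrix_mprod_block)
  have reverse: "f (\<lambda>j. M (\<sigma> (2 * j)) (\<sigma> (2 * j + 1))) =
      - f (\<lambda>j. M (\<sigma> (2 * (k - 1 - j))) (\<sigma> (2 * (k - 1 - j) + 1)))" if "\<sigma> \<in> ?P" for \<sigma>
    unfolding f_def
  proof (rule mtrace_reverse[OF gram_sym gram_pos _ J_matrix_adjoint])
    show "(\<Sum>c<2 * m. M (\<sigma> (2 * l)) (\<sigma> (2 * l + 1)) c i * gram c j) =
        (\<Sum>c<2 * m. gram i c * M (\<sigma> (2 * l)) (\<sigma> (2 * l + 1)) c j)"
      if "l < k" "i < 2 * m" "j < 2 * m" for l i j
      unfolding M_def using \<open>\<sigma> \<in> ?P\<close> that by (intro JR_matrix_adjoint permuted_fib) auto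
  qed
  let ?S = "\<Sum>\<sigma>\<in>?P. of_int (sign \<sigma>) * f (\<lambda>j. M (\<sigma> (2 * j)) (\<sigma> (2 * j + 1)))"
  have "?S = (\<Sum>\<sigma>\<in>?P. of_int (sign \<sigma>) *
      f (\<lambda>j. M (\<sigma> (2 * (k - 1 - j))) (\<sigma> (2 * (k - 1 - j) + 1))))"
  proof (rule sum_permutations_reverse_pairs[of k f M])
    show "f h = f h'" if "\<And>j. j < k \<Longrightarrow> h j = h' j" for h h'
      unfolding f_def by (subst mprod_cong[OF that]) auto
  qed
  also have "\<dots> = - ?S"
    unfolding sum_negf[symmetric]
    by (rule sum.cong[OF refl]) (simp only: reverse mult_minus_right minus_minus)
  finally have "?S = 0"
    by simp
  moreover have "?S = - 2 * (\<Sum>\<sigma>\<in>?P. of_int (sign \<sigma>) * Im (trace_term \<sigma>))"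
    unfolding f sum_distrib_left by (rule sum.cong[OF refl], rule mult.left_commute)
  ultimately show ?thesis
    by linarith
qed

lemma chern_form_eq_JR_trace_form:
  "chern_form nab e k p v = complex_of_real (1 / 2 * JR_trace_form nab e k p v)"
proof -
  let ?P = "{\<sigma>. \<sigma> permutes {..<2 * k}}"
  have "chern_form nab e k p v = (\<Sum>\<sigma>\<in>?P. of_int (sign \<sigma>) *
      mtrace m (mprod m (\<lambda>j b a. \<i> * frame10_coord e p
        (curvC nab p (v (\<sigma> (2 * j))) (v (\<sigma> (2 * j + 1))) (frame10 e a p)) b) k)) / 2 ^ k"
    unfolding chern_form_def
    by (rule form_trace_power_eq[where Y = "\<lambda>b a x y.
          \<i> * frame10_coord e p (curvC nab p x y (frame10 e a p)) b"])
      (simp add: curvature_matrix_def)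
  also have "\<dots> = (\<Sum>\<sigma>\<in>?P. of_int (sign \<sigma>) * trace_term \<sigma>) / 2 ^ k"
  proof (intro arg_cong[where f = "\<lambda>x. x / 2 ^ k"] sum.cong refl arg_cong2[where f = "(*)"])
    fix \<sigma> assume \<sigma>: "\<sigma> \<in> ?P"
    show "mtrace m (mprod m (\<lambda>j b a. \<i> * frame10_coord e p
        (curvC nab p (v (\<sigma> (2 * j))) (v (\<sigma> (2 * j + 1))) (frame10 e a p)) b) k) = trace_term \<sigma>"
      unfolding trace_term_def mtrace_def
    proof (intro sum.cong refl mprod_entry_cong)
      fix j b a assume "j < k" "b < m" "a < m"
      then show "\<i> * frame10_coord e p
          (curvC nab p (v (\<sigma> (2 * j))) (v (\<sigma> (2 * j + 1))) (frame10 e a p)) b =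
        Complex (RM b a (v (\<sigma> (2 * j))) (v (\<sigma> (2 * j + 1))))
          (RsM b a (v (\<sigma> (2 * j))) (v (\<sigma> (2 * j + 1))))"
        using curvature_matrix_eq[of "\<lambda>i. v (\<sigma> (2 * j + i))" b a] permuted_fib[of \<sigma> j] \<sigma>
        by (simp add: curvature_matrix_def)
    qed auto
  qed
  finally have chern: "chern_form nab e k p v =
      (\<Sum>\<sigma>\<in>?P. of_int (sign \<sigma>) * trace_term \<sigma>) / 2 ^ k" .
  have "JR_trace_form nab e k p v = (\<Sum>\<sigma>\<in>?P. of_int (sign \<sigma>) * mtrace (2 * m)
      (mprod (2 * m) (\<lambda>j b a. JR_matrix (v (\<sigma> (2 * j))) (v (\<sigma> (2 * j + 1))) b a) k)) / 2 ^ k"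
    unfolding JR_trace_form_def
    by (rule form_trace_power_eq[where Y = "\<lambda>b a x y. JR_matrix x y b a"])
      (simp add: block_matrix_def block_def R_form_def R_star_form_def)
  also have "\<dots> = (\<Sum>\<sigma>\<in>?P. of_int (sign \<sigma>) * (2 * Re (trace_term \<sigma>))) / 2 ^ k"
    by (simp only: mtrace_mprod_block trace_term_def)
  also have "\<dots> = 2 * ((\<Sum>\<sigma>\<in>?P. of_int (sign \<sigma>) * Re (trace_term \<sigma>)) / 2 ^ k)"
    by (simp only: sum_distrib_left mult.left_commute[of _ 2] times_divide_eq_right)
  finally have JR: "1 / 2 * JR_trace_form nab e k p v =
      (\<Sum>\<sigma>\<in>?P. of_int (sign \<sigma>) * Re (trace_term \<sigma>)) / 2 ^ k"
    by simp
  have "(\<Sum>\<sigma>\<in>?P. of_int (sign \<sigma>) * trace_term \<sigma>) =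
      complex_of_real (\<Sum>\<sigma>\<in>?P. of_int (sign \<sigma>) * Re (trace_term \<sigma>))"
    using sum_Im_trace_term by (simp add: complex_eq_iff)
  then show ?thesis
    unfolding chern JR by simp
qed

end

end

end

end

end

theorem theorem4p1:
  fixes m k :: nat
  assumes "k \<le> m"
  shows "\<exists>c::real. c \<noteq> 0 \<and>
    (\<forall>(n::nat)
      (A :: ('p::{t2_space, second_countable_topology} set \<times> ('p \<Rightarrow> nat \<Rightarrow> real)) set)
      (fib :: 'p \<Rightarrow> 'v::real_vector set) B \<rho> br J nab U e.
        almost_complex_lie_algebroid n A m fib B \<rho> br J \<longrightarrow>
        almost_complex_lie_algebroid.almost_complex_connection n A m fib B \<rho> J nab \<longrightarrow>
        (\<exists>g. almost_complex_lie_algebroid.hermitian_metric n A m fib B J g \<and>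
             lie_algebroid.metric_compatible n A (2 * m) fib B \<rho> g nab) \<longrightarrow>
        almost_complex_lie_algebroid.local_J_frame n A m fib B J U e \<longrightarrow>
        (\<forall>p\<in>U. \<forall>v. (\<forall>i<2 * k. v i \<in> fib p) \<longrightarrow>
          almost_complex_lie_algebroid.chern_form n A m fib B br J nab e k p v =
          complex_of_real
            (c * almost_complex_lie_algebroid.JR_trace_form n A m fib B br J nab e k p v)))"
proof (intro exI[of _ "1 / 2 :: real"] conjI allI impI ballI)
  fix n :: nat and A :: "('p set \<times> ('p \<Rightarrow> nat \<Rightarrow> real)) set" and fib :: "'p \<Rightarrow> 'v set"
    and B \<rho> br J nab U e p v
  assume "almost_complex_lie_algebroid n A m fib B \<rho> br J"
  then interpret almost_complex_lie_algebroid n A m fib B \<rho> br J .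
  assume ac: "almost_complex_connection nab" and "\<exists>g. hermitian_metric g \<and> metric_compatible g nab"
    and frame: "local_J_frame U e" and p: "p \<in> U" and v: "\<forall>i<2 * k. v i \<in> fib p"
  then obtain g where g: "hermitian_metric g" "metric_compatible g nab"
    by blast
  show "chern_form nab e k p v = complex_of_real (1 / 2 * JR_trace_form nab e k p v)"
    by (rule chern_form_eq_JR_trace_form[OF frame p ac g]) (use v in blast)
qed simp

end
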